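(* Let $A$ be a real associative algebra (not assumed commutative or unital). Let $p : A \to [0,\infty)$ be a seminorm on the real vector space $A$ satisfying the square property, i.e. $p(a^2) = p(a)^2$ for all $a \in A$. Then $p$ is submultiplicative, i.e. $p(ab) \leq p(a)\,p(b)$ for all $a, b \in A$.
   Context: A seminorm on a real algebra $A$ is a function $p : A \to [0,\infty)$ such that $p(a+b) \leq p(a) + p(b)$ for all $a,b \in A$ and $p(ka) = |k|\,p(a)$ for all $a \in A$ and $k \in \mathbb{R}$. No compatibility of $p$ with the multiplication, other than the square property, is part of the definition. *)

theory Defs
  imports Complex_Main
begin

definition seminorm :: "('a::real_vector \<Rightarrow> real) \<Rightarrow> bool" where
  "seminorm p \<longleftrightarrow>
    (\<forall>a. 0 \<le> p a) \<and>
    (\<forall>a b. p (a + b) \<le> p a + p b) \<and>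
    (\<forall>k a. p (k *\<^sub>R a) = \<bar>k\<bar> * p a)"

text \<open>The square is written \<open>a * a\<close>, since \<open>a ^ 2\<close> requires a unit.\<close>
definition square_property :: "('a::real_algebra \<Rightarrow> real) \<Rightarrow> bool" where
  "square_property p \<longleftrightarrow> (\<forall>a. p (a * a) = (p a)\<^sup>2)"

definition submultiplicative :: "('a::real_algebra \<Rightarrow> real) \<Rightarrow> bool" where
  "submultiplicative p \<longleftrightarrow> (\<forall>a b. p (a * b) \<le> p a * p b)"

end

theory Submission
  imports Defs
begin

text \<open>Jordan identities give \<open>p (a b) \<le> 6 p a p b\<close>, so \<open>p\<close> behaves like a spectral radius:
  \<open>p (a\<^sup>n) = (p a)\<^sup>n\<close> and \<open>p (a b) = p (b a)\<close>. Put \<open>w = a b\<close> and \<open>q = p w > 0\<close>. In the unitization,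
  \<open>w\<close> has an approximate eigenvalue \<open>z\<close> with \<open>\<bar>z\<bar> = q\<close>, so some maximal left ideal \<open>L\<close> contains
  \<open>(w - z) (w - z')\<close>, where \<open>z'\<close> is the complex conjugate of \<open>z\<close>. Since \<open>p\<close> is subadditive and
  invariant under inner automorphisms, no \<open>2 \<times> 2\<close> matrix units can act on the quotient by \<open>L\<close>;
  hence \<open>L\<close> is two-sided and the quotient is, up to completion, a normed division algebra, all of
  whose elements are quadratic over the reals. As in Frobenius' theorem its absolute value is
  multiplicative, so \<open>q = \<bar>w\<bar> = \<bar>a\<bar> \<bar>b\<bar> \<le> p a p b\<close>. Completions are avoided by working with sequences
  modulo \<open>L\<close> and null sequences.\<close>

text \<open>The obstacle is that the unitization is real, noncommutative and incomplete. An element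
  at distance less than 1 from the unit need not be invertible, and an ideal avoiding the unit may
  be dense. So a left ideal counts as proper only if it keeps distance at least 1 from the unit.
  Conjugate pairs z, z' enter only through real quadratics with constant term \<rho> squared. That
  such a quadratic is not bounded below is usually read off from the singularities of the resolvent
  on the spectral circle; here finite cosine averages take the place of Cauchy's integral. An
  approximate eigenvalue yields a one-sided ideal only, and the square property is what makes it
  two-sided. Constants such as 6 and \<open>M\<close> are harmless in the end: estimates are applied
  to high powers and only exponential growth rates are compared.\<close>

section \<open>Discrete orthogonality of cosines and cosine generating functions\<close>

lemma sum_cos_roots:
  fixes d m :: nat
  assumes "0 < d" "d < m"
  shows "(\<Sum>k<m. cos (real d * (2 * pi * real k / real m))) = 0"
proof -
  let ?z = "cis (2 * pi * real d / real m)"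
  have ne: "?z \<noteq> 1"
  proof
    assume "?z = 1"
    then have "cos (2 * pi * real d / real m) = 1"
      by (metis cis.simps(1) one_complex.simps(1))
    then obtain n :: int where "2 * pi * real d / real m = of_int n * 2 * pi"
      by (auto simp: cos_one_2pi_int)
    then have "real d = of_int n * real m"
      using assms by (simp add: field_simps)
    then have "int d = n * int m"
      by (metis of_int_eq_iff of_int_mult of_int_of_nat_eq)
    then have "int m dvd int d" by simp
    then have "m dvd d" by simp
    with assms show False by (auto dest: dvd_imp_le)
  qed
  have "?z ^ m = 1"
    using assms cis_multiple_2pi[of "real d"] by (simp add: Complex.DeMoivre)
  then have "(\<Sum>k<m. ?z ^ k) = 0"
    using ne by (simp add: geometric_sum)
  then have "(\<Sum>k<m. Re (?z ^ k)) = 0"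
    by (metis Re_sum zero_complex.simps(1))
  then show ?thesis
    by (simp add: Complex.DeMoivre field_simps)
qed

text \<open>By the product-to-sum formula only the frequencies \<open>i + j\<close> and the distance
  of \<open>i\<close> and \<open>j\<close> occur. The hypotheses put \<open>i + j\<close> strictly
  between 0 and \<open>m\<close>, so it cannot alias to the constant frequency.\<close>

lemma sum_cos_orthogonal:
  fixes i j m :: nat
  assumes "0 < i" "i + j < m"
  shows "(\<Sum>k<m. 2 * cos (real i * (2 * pi * real k / real m)) * cos (real j * (2 * pi * real k / real m)))
          = (if i = j then real m else 0)"
proof -
  let ?t = "\<lambda>k. 2 * pi * real k / real m"
  define d where "d = (if i \<le> j then j - i else i - j)"
  have "2 * cos (real i * ?t k) * cos (real j * ?t k) = cos (real (i + j) * ?t k) + cos (real d * ?t k)" for k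
  proof -
    have "cos (real d * ?t k) = cos (real i * ?t k - real j * ?t k)"
    proof (cases "i \<le> j")
      case True
      then have "real d * ?t k = - (real i * ?t k - real j * ?t k)"
        by (simp only: d_def if_True of_nat_diff left_diff_distrib minus_diff_eq)
      then show ?thesis by (metis cos_minus)
    next
      case False
      then show ?thesis
        by (simp add: d_def of_nat_diff left_diff_distrib diff_divide_distrib)
    qed
    moreover have "cos (real (i + j) * ?t k) = cos (real i * ?t k + real j * ?t k)"
      by (simp only: of_nat_add distrib_right)
    ultimately show ?thesis by (simp add: cos_add cos_diff)
  qed
  then have eq: "(\<Sum>k<m. 2 * cos (real i * ?t k) * cos (real j * ?t k))
      = (\<Sum>k<m. cos (real (i + j) * ?t k)) + (\<Sum>k<m. cos (real d * ?t k))"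
    by (simp add: sum.distrib)
  have "(\<Sum>k<m. cos (real (i + j) * ?t k)) = 0"
    using assms by (intro sum_cos_roots) auto
  moreover have "(\<Sum>k<m. cos (real d * ?t k)) = (if i = j then real m else 0)"
  proof (cases "i = j")
    case False
    then have "0 < d" "d < m" using assms by (auto simp: d_def split: if_splits)
    then show ?thesis using False sum_cos_roots by simp
  qed (simp add: d_def)
  ultimately show ?thesis unfolding eq by simp
qed

lemma cos_times_Suc_Suc: "cos (real (Suc (Suc n)) * t) = 2 * cos t * cos (real (Suc n) * t) - cos (real n * t)"
proof -
  have "real (Suc (Suc n)) * t = real (Suc n) * t + t" "real n * t = real (Suc n) * t - t"
    by (simp_all add: algebra_simps)
  then show ?thesis by (simp only: cos_add cos_diff) simp
qed

text \<open>The left factor is the product of 1 - e^(it) x and 1 - e^(-it) x. The identity is the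
  generating function of cos (j t), the real part of the geometric series in e^(it) x, truncated
  after degree \<open>n\<close>; the last two terms are the boundary terms.\<close>

lemma cos_power_sum_identity:
  fixes x :: "'u::real_algebra_1" and t :: real
  defines "c \<equiv> \<lambda>k. cos (real k * t)"
  shows "(1 - (2 * cos t) *\<^sub>R x + x * x) * (\<Sum>j<Suc n. c j *\<^sub>R x ^ j)
      = 1 - cos t *\<^sub>R x - c (Suc n) *\<^sub>R x ^ Suc n + c n *\<^sub>R x ^ Suc (Suc n)"
proof (induction n)
  case 0
  show ?case by (simp add: c_def scaleR_2 algebra_simps flip: scaleR_scaleR)
next
  case (Suc n)
  have c: "c (Suc (Suc n)) = 2 * cos t * c (Suc n) - c n"
    unfolding c_def by (rule cos_times_Suc_Suc)
  show ?case
    unfolding sum.lessThan_Suc[of _ "Suc n"] distrib_left Suc c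
    by (simp add: algebra_simps power_commutes)
qed

text \<open>Formally this is the Euler operator x d/dx applied to
  \<open>cos_power_sum_identity\<close>. The weight j is essential: it leads to a bound on
  \<open>real i * N (x ^ i)\<close> that is uniform in \<open>i\<close>, and this contradicts
  \<open>1 \<le> N (x ^ i)\<close>. Unweighted sums would only bound
  \<open>N (x ^ i)\<close>.\<close>

lemma cos_power_sum_derivative_identity:
  fixes x :: "'u::real_algebra_1" and t :: real
  defines "c \<equiv> \<lambda>k. cos (real k * t)"
  shows "(1 - (2 * cos t) *\<^sub>R x + x * x) * (\<Sum>j<Suc n. (real j * c j) *\<^sub>R x ^ j)
      = - (cos t *\<^sub>R x) - (real (Suc n) * c (Suc n)) *\<^sub>R x ^ Suc n
        + (real (Suc (Suc n)) * c n) *\<^sub>R x ^ Suc (Suc n)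
        - (2 *\<^sub>R (x * x) - (2 * cos t) *\<^sub>R x) * (\<Sum>j<Suc n. c j *\<^sub>R x ^ j)"
proof (induction n)
  case 0
  show ?case by (simp add: c_def scaleR_2 algebra_simps flip: scaleR_scaleR)
next
  case (Suc n)
  have c: "c (Suc (Suc n)) = 2 * cos t * c (Suc n) - c n"
    unfolding c_def by (rule cos_times_Suc_Suc)
  have multiples: "(3 * a) *\<^sub>R y = a *\<^sub>R y + (a *\<^sub>R y + a *\<^sub>R y)"
      "(a * (b * 4)) *\<^sub>R y = (a * (2 * b)) *\<^sub>R y + (a * (2 * b)) *\<^sub>R y" for a b and y :: 'u
    by (simp_all flip: scaleR_add_left)
  show ?case
    unfolding sum.lessThan_Suc[of _ "Suc n"] distrib_left Suc c
    by (simp add: algebra_simps power_commutes scaleR_2 multiples)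
qed

section \<open>Approximate roots of quadratic polynomials\<close>

locale unital_seminorm =
  fixes N :: "'u::real_algebra_1 \<Rightarrow> real"
  assumes N_add: "N (x + y) \<le> N x + N y"
    and N_scaleR: "N (c *\<^sub>R x) = \<bar>c\<bar> * N x"
    and N_mult: "N (x * y) \<le> N x * N y"
    and N_one: "N 1 = 1"
begin

lemma N_zero [simp]: "N 0 = 0"
  using N_scaleR[of 0 0] by simp

lemma N_uminus [simp]: "N (- x) = N x"
  using N_scaleR[of "-1" x] by simp

lemma N_nonneg [simp]: "0 \<le> N x"
  using N_add[of x "- x"] by simp

lemma N_diff: "N (x - y) \<le> N x + N y"
  using N_add[of x "- y"] by simp

lemma N_sum: "N (sum f A) \<le> (\<Sum>i\<in>A. N (f i))"
proof (induction A rule: infinite_finite_induct)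
  case (insert a A)
  then show ?case using N_add[of "f a" "sum f A"] by simp
qed simp_all

lemma N_power: "N (x ^ n) \<le> N x ^ n"
proof (induction n)
  case (Suc n)
  have "N (x * x ^ n) \<le> N x * N (x ^ n)" by (rule N_mult)
  also have "\<dots> \<le> N x * N x ^ n" using Suc by (intro mult_left_mono) auto
  finally show ?case by simp
qed (simp add: N_one)

lemma N_mult_le: "N x \<le> a \<Longrightarrow> N y \<le> b \<Longrightarrow> N (x * y) \<le> a * b"
  using N_mult[of x y] mult_mono[of "N x" a "N y" b] by (meson N_nonneg order_trans)

text \<open>If the quadratic polynomials with roots on the unit circle are uniformly bounded below at \<open>x\<close>,
  then the sums \<open>\<Sum>j. j cos (j t) x\<^sup>j\<close> are bounded, and their averages over equidistant \<open>t\<close>, with weight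
  \<open>2 cos (i t)\<close>, recover \<open>i x\<^sup>i\<close>.\<close>

lemma power_decay:
  fixes x :: 'u
  assumes K: "0 < \<kappa>"
    and lower: "\<And>s y. \<bar>s\<bar> \<le> 1 \<Longrightarrow> \<kappa> * N y \<le> N ((1 - (2 * s) *\<^sub>R x + x * x) * y)"
    and lim: "(\<lambda>j. real j * N (x ^ j)) \<longlonglongrightarrow> 0"
    and B: "N x \<le> B"
    and i: "0 < i"
  shows "real i * N (x ^ i) \<le> 2 * ((B + 2 + (2 * B\<^sup>2 + 2 * B) * ((3 + B) / \<kappa>)) / \<kappa>)"
proof -
  define C where "C = (3 + B) / \<kappa>"
  define D where "D = (B + 2 + (2 * B\<^sup>2 + 2 * B) * C) / \<kappa>"
  have B0: "0 \<le> B" using B N_nonneg order_trans by blast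
  have "\<forall>\<^sub>F j in sequentially. real j * N (x ^ j) < 1"
    using order_tendstoD(2)[OF lim] by simp
  then obtain J where J: "\<And>j. j \<ge> J \<Longrightarrow> real j * N (x ^ j) < 1"
    by (auto simp: eventually_sequentially)
  \<comment> \<open>Beyond \<open>J\<close> the boundary terms of both identities have norm at most
    1, and \<open>i \<le> n\<close> ensures that the i-th term occurs in the sums.\<close>
  define n where "n = J + i"
  have small: "real j * N (x ^ j) \<le> 1" "N (x ^ j) \<le> 1" if "j = Suc n \<or> j = Suc (Suc n)" for j
  proof -
    show 1: "real j * N (x ^ j) \<le> 1" using J[of j] that by (auto simp: n_def)
    have "1 * N (x ^ j) \<le> real j * N (x ^ j)"
      using that by (intro mult_right_mono) auto
    with 1 show "N (x ^ j) \<le> 1" by simp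
  qed
  define c where "c = (\<lambda>t k. cos (real k * t))"
  define Q where "Q = (\<lambda>t. \<Sum>j<Suc n. c t j *\<^sub>R x ^ j)"
  define W where "W = (\<lambda>t. \<Sum>j<Suc n. (real j * c t j) *\<^sub>R x ^ j)"
  have c1: "\<bar>c t k\<bar> \<le> 1" for t k by (simp add: c_def)
  have sc: "N (r *\<^sub>R y) \<le> b" if "\<bar>r\<bar> \<le> 1" "N y \<le> b" for r y b
    using mult_mono[OF that(1) that(2)] by (simp add: N_scaleR)
  have Q: "N (Q t) \<le> C" for t
  proof -
    have "\<kappa> * N (Q t) \<le> N ((1 - (2 * cos t) *\<^sub>R x + x * x) * Q t)"
      by (intro lower) simp
    also have "\<dots> = N (1 - cos t *\<^sub>R x - c t (Suc n) *\<^sub>R x ^ Suc n + c t n *\<^sub>R x ^ Suc (Suc n))"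
      unfolding Q_def c_def by (simp only: cos_power_sum_identity)
    also have "\<dots> \<le> N 1 + N (cos t *\<^sub>R x) + N (c t (Suc n) *\<^sub>R x ^ Suc n) + N (c t n *\<^sub>R x ^ Suc (Suc n))"
      by (meson N_add N_diff add_right_mono order_trans)
    also have "\<dots> \<le> 1 + B + 1 + 1"
      using B N_one by (intro add_mono sc c1 small) auto
    finally show ?thesis using K by (simp add: C_def field_simps)
  qed
  have W: "N (W t) \<le> D" for t
  proof -
    have "\<kappa> * N (W t) \<le> N ((1 - (2 * cos t) *\<^sub>R x + x * x) * W t)"
      by (intro lower) simp
    also have "\<dots> = N (- (cos t *\<^sub>R x) - (real (Suc n) * c t (Suc n)) *\<^sub>R x ^ Suc n
        + (real (Suc (Suc n)) * c t n) *\<^sub>R x ^ Suc (Suc n)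
        - (2 *\<^sub>R (x * x) - (2 * cos t) *\<^sub>R x) * Q t)"
      unfolding W_def Q_def c_def by (simp only: cos_power_sum_derivative_identity)
    also have "\<dots> \<le> N (- (cos t *\<^sub>R x)) + N ((real (Suc n) * c t (Suc n)) *\<^sub>R x ^ Suc n)
        + N ((real (Suc (Suc n)) * c t n) *\<^sub>R x ^ Suc (Suc n))
        + N ((2 *\<^sub>R (x * x) - (2 * cos t) *\<^sub>R x) * Q t)"
      by (meson N_add N_diff add_right_mono order_trans)
    also have "\<dots> \<le> B + 1 + 1 + (2 * B\<^sup>2 + 2 * B) * C"
    proof (intro add_mono N_mult_le Q)
      show "N (- (cos t *\<^sub>R x)) \<le> B" using B by (simp add: sc)
      have *: "N ((real j * c t k) *\<^sub>R x ^ j) \<le> 1" if "j = Suc n \<or> j = Suc (Suc n)" for j k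
      proof -
        have "N ((real j * c t k) *\<^sub>R x ^ j) = \<bar>c t k\<bar> * (real j * N (x ^ j))"
          by (simp add: N_scaleR abs_mult)
        also have "\<dots> \<le> 1 * 1" using small(1)[OF that] c1 by (intro mult_mono) auto
        finally show ?thesis by simp
      qed
      show "N ((real (Suc n) * c t (Suc n)) *\<^sub>R x ^ Suc n) \<le> 1"
        and "N ((real (Suc (Suc n)) * c t n) *\<^sub>R x ^ Suc (Suc n)) \<le> 1"
        by (rule *; simp)+
      have "N (2 *\<^sub>R (x * x) - (2 * cos t) *\<^sub>R x) \<le> N (2 *\<^sub>R (x * x)) + N ((2 * cos t) *\<^sub>R x)"
        by (rule N_diff)
      also have "\<dots> \<le> 2 * B\<^sup>2 + 2 * B"
      proof (rule add_mono)
        show "N (2 *\<^sub>R (x * x)) \<le> 2 * B\<^sup>2"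
          using N_mult_le[OF B B] by (simp add: N_scaleR power2_eq_square)
        have "\<bar>cos t\<bar> * N x \<le> 1 * B" using B by (intro mult_mono) auto
        then show "N ((2 * cos t) *\<^sub>R x) \<le> 2 * B" by (simp add: N_scaleR abs_mult)
      qed
      finally show "N (2 *\<^sub>R (x * x) - (2 * cos t) *\<^sub>R x) \<le> 2 * B\<^sup>2 + 2 * B" .
    qed
    finally show ?thesis using K by (simp add: D_def field_simps)
  qed
  \<comment> \<open>Enough sample points that \<open>i + j < m\<close> for all exponents up to
    \<open>n\<close>.\<close>
  define m where "m = 2 * Suc n"
  define \<theta> where "\<theta> = (\<lambda>k. 2 * pi * real k / real m)"
  have m0: "0 < m" by (simp add: m_def)
  have "(\<Sum>k<m. (2 * c (\<theta> k) i) *\<^sub>R W (\<theta> k))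
      = (\<Sum>k<m. \<Sum>j<Suc n. (real j * (2 * c (\<theta> k) i * c (\<theta> k) j)) *\<^sub>R x ^ j)"
    by (simp only: W_def scaleR_sum_right scaleR_scaleR mult.assoc mult.left_commute)
  also have "\<dots> = (\<Sum>j<Suc n. \<Sum>k<m. (real j * (2 * c (\<theta> k) i * c (\<theta> k) j)) *\<^sub>R x ^ j)"
    by (rule sum.swap)
  also have "\<dots> = (\<Sum>j<Suc n. (real j * (\<Sum>k<m. 2 * c (\<theta> k) i * c (\<theta> k) j)) *\<^sub>R x ^ j)"
    by (simp only: scaleR_sum_left sum_distrib_left)
  also have "\<dots> = (\<Sum>j<Suc n. (if i = j then real m * real i else 0) *\<^sub>R x ^ j)"
  proof (rule sum.cong)
    fix j assume "j \<in> {..<Suc n}"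
    then have "i + j < m" by (simp add: m_def n_def)
    then have "(\<Sum>k<m. 2 * c (\<theta> k) i * c (\<theta> k) j) = (if i = j then real m else 0)"
      unfolding c_def \<theta>_def by (intro sum_cos_orthogonal i)
    then show "(real j * (\<Sum>k<m. 2 * c (\<theta> k) i * c (\<theta> k) j)) *\<^sub>R x ^ j
        = (if i = j then real m * real i else 0) *\<^sub>R x ^ j" by simp
  qed simp
  also have "\<dots> = (\<Sum>j<Suc n. if i = j then (real m * real i) *\<^sub>R x ^ j else 0)"
    by (intro sum.cong) auto
  also have "\<dots> = (real m * real i) *\<^sub>R x ^ i" by (simp add: n_def)
  finally have "real m * (real i * N (x ^ i)) = N (\<Sum>k<m. (2 * c (\<theta> k) i) *\<^sub>R W (\<theta> k))"
    by (simp add: N_scaleR abs_mult)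
  also have "\<dots> \<le> (\<Sum>k<m. N ((2 * c (\<theta> k) i) *\<^sub>R W (\<theta> k)))" by (rule N_sum)
  also have "\<dots> \<le> (\<Sum>k<m. 2 * D)"
  proof (rule sum_mono)
    fix k
    have "\<bar>c (\<theta> k) i\<bar> * N (W (\<theta> k)) \<le> 1 * D" by (intro mult_mono c1 W) auto
    then show "N ((2 * c (\<theta> k) i) *\<^sub>R W (\<theta> k)) \<le> 2 * D" by (simp add: N_scaleR abs_mult)
  qed
  finally have "real m * (real i * N (x ^ i)) \<le> real m * (2 * D)" by simp
  then have "real i * N (x ^ i) \<le> 2 * D" using m0 by simp
  then show ?thesis by (simp add: D_def C_def)
qed

end

lemma power_scaleR: "(c *\<^sub>R x) ^ n = c ^ n *\<^sub>R x ^ n" for x :: "'u::real_algebra_1"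
  by (induction n) simp_all

context unital_seminorm
begin

text \<open>Compactness of [-1, 1]. If the bounds degenerate along parameters tending to
  \<open>l\<close>, the polynomial at \<open>l\<close> differs from those by a small multiple of
  \<open>x\<close>, which contradicts its own lower bound.\<close>

lemma quadratic_uniform_lower_bound:
  assumes "\<And>s. \<bar>s\<bar> \<le> 1 \<Longrightarrow> \<exists>\<epsilon>>0. \<forall>y. \<epsilon> * N y \<le> N ((1 - (2 * s) *\<^sub>R x + x * x) * y)"
  shows "\<exists>\<kappa>>0. \<forall>s y. \<bar>s\<bar> \<le> 1 \<longrightarrow> \<kappa> * N y \<le> N ((1 - (2 * s) *\<^sub>R x + x * x) * y)"
proof (rule ccontr)
  define g where "g = (\<lambda>s. 1 - (2 * s) *\<^sub>R x + x * x)"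
  assume neg: "\<not> ?thesis"
  have "\<exists>s y. \<bar>s\<bar> \<le> 1 \<and> N (g s * y) < inverse (real (Suc n)) * N y" for n
  proof -
    have "inverse (real (Suc n)) > 0" by simp
    with neg show ?thesis unfolding g_def by (meson not_le)
  qed
  then obtain s y where s: "\<And>n. \<bar>s n\<bar> \<le> 1"
    and y: "\<And>n. N (g (s n) * y n) < inverse (real (Suc n)) * N (y n)" by metis
  obtain r where r: "strict_mono r" and mono: "monoseq (\<lambda>n. s (r n))"
    using seq_monosub by blast
  have "Bseq (\<lambda>n. s (r n))" using s by (intro BseqI'[of _ 1]) simp
  then obtain l where lim: "(\<lambda>n. s (r n)) \<longlonglongrightarrow> l"
    using Bseq_monoseq_convergent[OF _ mono] by (auto simp: convergent_def)
  have "-1 \<le> l" "l \<le> 1"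
    using s by (auto intro!: LIMSEQ_le_const[OF lim] LIMSEQ_le_const2[OF lim] simp: abs_le_iff minus_le_iff)
  then have "\<bar>l\<bar> \<le> 1" by auto
  from assms[OF this] obtain e where e: "e > 0" and lower: "\<And>y. e * N y \<le> N (g l * y)"
    unfolding g_def by blast
  have inv: "(\<lambda>n. inverse (real (Suc (r n)))) \<longlonglongrightarrow> 0"
    using LIMSEQ_subseq_LIMSEQ[OF LIMSEQ_inverse_real_of_nat r] by (simp add: o_def)
  have "(\<lambda>n. inverse (real (Suc (r n))) + 2 * \<bar>s (r n) - l\<bar> * N x) \<longlonglongrightarrow> 0 + 2 * \<bar>l - l\<bar> * N x"
    by (intro tendsto_intros inv lim)
  then have "\<forall>\<^sub>F n in sequentially. inverse (real (Suc (r n))) + 2 * \<bar>s (r n) - l\<bar> * N x < e"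
    using e by (intro order_tendstoD(2)) auto
  then obtain n where n: "inverse (real (Suc (r n))) + 2 * \<bar>s (r n) - l\<bar> * N x < e"
    by (auto simp: eventually_sequentially)
  let ?s = "s (r n)" and ?y = "y (r n)"
  have pos: "N ?y > 0"
  proof (rule ccontr)
    assume "\<not> N ?y > 0"
    then have "N ?y = 0" using N_nonneg[of ?y] by linarith
    then show False using y[of "r n"] N_nonneg[of "g ?s * ?y"] by simp
  qed
  have "g l * ?y = g ?s * ?y + (2 * (?s - l)) *\<^sub>R (x * ?y)"
    by (simp add: g_def algebra_simps)
  then have "N (g l * ?y) \<le> N (g ?s * ?y) + 2 * \<bar>?s - l\<bar> * N (x * ?y)"
    by (metis N_add N_scaleR abs_mult abs_numeral)
  also have "\<dots> \<le> inverse (real (Suc (r n))) * N ?y + 2 * \<bar>?s - l\<bar> * (N x * N ?y)"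
    using y[of "r n"] by (intro add_mono mult_left_mono N_mult) auto
  also have "\<dots> = (inverse (real (Suc (r n))) + 2 * \<bar>?s - l\<bar> * N x) * N ?y"
    by (simp add: algebra_simps)
  also have "\<dots> < e * N ?y" using n pos by simp
  finally show False using lower[of ?y] by simp
qed

text \<open>Otherwise all quadratics share a lower bound \<open>k\<close>. The powers of
  \<open>x\<close> do not decay, so \<open>power_decay\<close> is applied to
  \<open>r *\<^sub>R x\<close> with r < 1: there they decay geometrically, and for r close to 1 the
  perturbed quadratics keep the bound \<open>k / 2\<close>. The resulting \<open>D\<close> does not
  depend on r, and r tending to 1 gives \<open>real i * N (x ^ i) \<le> D\<close> for every positive
  i.\<close>

lemma approximate_root_on_unit_circle:
  assumes ge1: "\<And>n. 1 \<le> N (x ^ n)"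
    and upper: "\<And>\<sigma>. 1 < \<sigma> \<Longrightarrow> \<exists>C. \<forall>n. N (x ^ n) \<le> C * \<sigma> ^ n"
  shows "\<exists>s. \<bar>s\<bar> \<le> 1 \<and> (\<forall>\<epsilon>>0. \<exists>y. N ((1 - (2 * s) *\<^sub>R x + x * x) * y) < \<epsilon> * N y)"
proof (rule ccontr)
  assume "\<not> ?thesis"
  then have "\<exists>\<epsilon>>0. \<forall>y. \<epsilon> * N y \<le> N ((1 - (2 * s) *\<^sub>R x + x * x) * y)" if "\<bar>s\<bar> \<le> 1" for s
    using that by (meson not_le)
  then obtain k where k: "k > 0"
    and lower: "\<And>s y. \<bar>s\<bar> \<le> 1 \<Longrightarrow> k * N y \<le> N ((1 - (2 * s) *\<^sub>R x + x * x) * y)"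
    using quadratic_uniform_lower_bound[of x] by auto
  define B where "B = N x"
  have B: "B \<ge> 1" using ge1[of 1] by (simp add: B_def)
  define D where "D = 2 * ((B + 2 + (2 * B\<^sup>2 + 2 * B) * ((3 + B) / (k / 2))) / (k / 2))"
  have bound: "real i * (r ^ i * N (x ^ i)) \<le> D"
    if r: "0 < r" "r < 1" "(1 - r) * (2 * B + 2 * B\<^sup>2) \<le> k / 2" and i: "0 < i" for r i
  proof -
    let ?x = "r *\<^sub>R x"
    have Npow: "N (?x ^ j) = r ^ j * N (x ^ j)" for j
      using r by (simp add: N_scaleR power_scaleR)
    have "real i * N (?x ^ i) \<le> D"
      unfolding D_def
    proof (rule power_decay)
      show "0 < k / 2" using k by simp
      show "N ?x \<le> B" using r B by (simp add: N_scaleR B_def mult_left_le_one_le)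
      fix s :: real and y :: 'u assume s: "\<bar>s\<bar> \<le> 1"
      let ?g = "1 - (2 * s) *\<^sub>R x + x * x" and ?h = "1 - (2 * s) *\<^sub>R ?x + ?x * ?x"
      let ?d = "((1 - r) * (1 + r)) *\<^sub>R (x * x) - (2 * s * (1 - r)) *\<^sub>R x"
      have "?g = ?h + ?d" by (simp add: algebra_simps)
      then have "N (?g * y) \<le> N (?h * y) + N (?d * y)"
        by (metis N_add distrib_right)
      moreover have "N (?d * y) \<le> k / 2 * N y"
      proof (rule N_mult_le)
        have "N ?d \<le> N (((1 - r) * (1 + r)) *\<^sub>R (x * x)) + N ((2 * s * (1 - r)) *\<^sub>R x)"
          by (rule N_diff)
        also have "\<dots> = (1 - r) * (1 + r) * N (x * x) + (2 * \<bar>s\<bar>) * (1 - r) * N x"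
          using r by (simp add: N_scaleR abs_mult)
        also have "\<dots> \<le> (1 - r) * 2 * B\<^sup>2 + 2 * (1 - r) * B"
          using r s N_mult[of x x] by (intro add_mono mult_mono) (auto simp: B_def power2_eq_square)
        also have "\<dots> = (1 - r) * (2 * B + 2 * B\<^sup>2)" by (simp add: algebra_simps)
        finally show "N ?d \<le> k / 2" using r by simp
      qed simp
      ultimately show "k / 2 * N y \<le> N (?h * y)" using lower[OF s, of y] by simp
    next
      \<comment> \<open>Midpoint of 1 and 1/r: above 1, so that \<open>upper\<close> applies, yet
        \<open>r * \<sigma> < 1\<close>.\<close>
      define \<sigma> where "\<sigma> = (1 + inverse r) / 2"
      have \<sigma>: "1 < \<sigma>" "0 \<le> r * \<sigma>" "r * \<sigma> < 1"
        using r by (auto simp: \<sigma>_def field_simps)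
      obtain C where C: "\<And>n. N (x ^ n) \<le> C * \<sigma> ^ n" using upper[OF \<sigma>(1)] by blast
      have "(\<lambda>j. C * (real j * (r * \<sigma>) ^ j)) \<longlonglongrightarrow> C * 0"
        using \<sigma> by (intro tendsto_mult_left) (rule powser_times_n_limit_0, simp)
      then have "(\<lambda>j. C * (real j * (r * \<sigma>) ^ j)) \<longlonglongrightarrow> 0" by simp
      then show "(\<lambda>j. real j * N (?x ^ j)) \<longlonglongrightarrow> 0"
      proof (rule tendsto_0_le[where K = 1], intro always_eventually allI)
        fix j
        have "real j * (r ^ j * N (x ^ j)) \<le> real j * (r ^ j * (C * \<sigma> ^ j))"
          using r C by (intro mult_left_mono) auto
        then have "real j * N (?x ^ j) \<le> C * (real j * (r * \<sigma>) ^ j)"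
          unfolding Npow by (simp add: power_mult_distrib mult_ac)
        then show "norm (real j * N (?x ^ j)) \<le> norm (C * (real j * (r * \<sigma>) ^ j)) * 1"
          by simp
      qed
    qed fact
    then show ?thesis unfolding Npow .
  qed
  obtain i :: nat where i: "real i > max 0 D" using reals_Archimedean2 by blast
  then have i0: "0 < i" by simp
  have ev: "\<forall>\<^sub>F r in at_left (1::real). 0 < r \<and> r < 1 \<and> (1 - r) * (2 * B + 2 * B\<^sup>2) \<le> k / 2"
  proof (intro eventually_conj)
    show "\<forall>\<^sub>F r in at_left (1::real). 0 < r" "\<forall>\<^sub>F r in at_left (1::real). r < 1"
      by (auto intro: eventually_at_leftI[of 0])
    have "((\<lambda>r. (1 - r) * (2 * B + 2 * B\<^sup>2)) \<longlongrightarrow> (1 - 1) * (2 * B + 2 * B\<^sup>2)) (at_left 1)"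
      by (intro tendsto_intros)
    then show "\<forall>\<^sub>F r in at_left (1::real). (1 - r) * (2 * B + 2 * B\<^sup>2) \<le> k / 2"
      using k by (intro eventually_mono[OF order_tendstoD(2)[of _ _ _ "k / 2"]]) auto
  qed
  have "((\<lambda>r. real i * (r ^ i * N (x ^ i))) \<longlongrightarrow> real i * (1 ^ i * N (x ^ i))) (at_left 1)"
    by (intro tendsto_intros)
  then have "real i * (1 ^ i * N (x ^ i)) \<le> D"
  proof (rule tendsto_upperbound)
    show "\<forall>\<^sub>F r in at_left 1. real i * (r ^ i * N (x ^ i)) \<le> D"
      using ev by eventually_elim (use bound i0 in blast)
  qed simp
  moreover have "real i * 1 \<le> real i * N (x ^ i)" using ge1 by (intro mult_left_mono) auto
  ultimately show False using i by simp
qed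

text \<open>The quadratic has conjugate roots of modulus \<rho>, so rescaling reduces the case of
  positive \<rho> to the unit circle. If \<rho> is 0, a lower bound \<epsilon> for multiplication by
  \<open>x * x\<close> would force \<open>N (x ^ (2 * n))\<close> to grow at least like
  \<epsilon>^n, against the rate allowed by \<open>upper\<close>.\<close>

lemma approximate_root:
  assumes \<rho>: "0 \<le> \<rho>"
    and lower: "\<And>n. \<rho> ^ n \<le> N (x ^ n)"
    and upper: "\<And>\<sigma>. \<rho> < \<sigma> \<Longrightarrow> \<exists>C. \<forall>n. N (x ^ n) \<le> C * \<sigma> ^ n"
  shows "\<exists>s. \<bar>s\<bar> \<le> \<rho> \<and> (\<forall>\<epsilon>>0. \<exists>y. N ((x * x - (2 * s) *\<^sub>R x + \<rho>\<^sup>2 *\<^sub>R 1) * y) < \<epsilon> * N y)"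
proof (cases "\<rho> = 0")
  case True
  have "\<exists>y. N ((x * x) * y) < \<epsilon> * N y" if e: "\<epsilon> > 0" for \<epsilon>
  proof (rule ccontr)
    assume neg: "\<not> ?thesis"
    define \<sigma> where "\<sigma> = sqrt (\<epsilon> / 2)"
    have \<sigma>: "0 < \<sigma>" "\<sigma>\<^sup>2 = \<epsilon> / 2" using e by (auto simp: \<sigma>_def)
    have "\<epsilon> ^ n \<le> N (x ^ (2 * n))" for n
    proof (induction n)
      case (Suc n)
      have "\<epsilon> * \<epsilon> ^ n \<le> \<epsilon> * N (x ^ (2 * n))" using Suc e by (intro mult_left_mono) auto
      also have "\<dots> \<le> N ((x * x) * x ^ (2 * n))" using neg by (meson not_le)
      finally show ?case by (simp add: mult.assoc)
    qed (simp add: N_one)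
    moreover obtain C where C: "\<And>n. N (x ^ n) \<le> C * \<sigma> ^ n"
      using upper[of \<sigma>] \<sigma> True by auto
    ultimately have le: "\<epsilon> ^ n \<le> C * (\<epsilon> / 2) ^ n" for n
      using order_trans[OF _ C[of "2 * n"]] by (simp add: power_mult \<sigma>)
    have "2 ^ n \<le> C" for n :: nat
    proof -
      have "\<epsilon> ^ n * 2 ^ n \<le> \<epsilon> ^ n * C"
        using le[of n] by (simp add: power_divide field_simps)
      then show ?thesis using e by simp
    qed
    moreover obtain n :: nat where "C < 2 ^ n"
      using real_arch_pow[of 2 C] by auto
    ultimately show False by (meson not_le)
  qed
  then show ?thesis using True by (intro exI[of _ 0]) simp
next
  case False
  with \<rho> have pos: "\<rho> > 0" by simp
  define z where "z = inverse \<rho> *\<^sub>R x"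
  have x: "x = \<rho> *\<^sub>R z" using pos by (simp add: z_def)
  have Nz: "N (z ^ n) = N (x ^ n) / \<rho> ^ n" for n
    using pos by (simp add: z_def N_scaleR power_scaleR field_simps)
  have "\<exists>s. \<bar>s\<bar> \<le> 1 \<and> (\<forall>\<epsilon>>0. \<exists>y. N ((1 - (2 * s) *\<^sub>R z + z * z) * y) < \<epsilon> * N y)"
  proof (rule approximate_root_on_unit_circle)
    show "1 \<le> N (z ^ n)" for n using lower[of n] pos by (simp add: Nz)
    fix \<sigma> :: real assume "1 < \<sigma>"
    then have "\<rho> < \<rho> * \<sigma>" using pos by simp
    from upper[OF this] obtain C where "\<And>n. N (x ^ n) \<le> C * (\<rho> * \<sigma>) ^ n" by blast
    then have "N (z ^ n) \<le> C * \<sigma> ^ n" for n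
      using pos by (simp add: Nz power_mult_distrib field_simps)
    then show "\<exists>C. \<forall>n. N (z ^ n) \<le> C * \<sigma> ^ n" by blast
  qed
  then obtain s where s: "\<bar>s\<bar> \<le> 1"
    and appr: "\<And>\<epsilon>. \<epsilon> > 0 \<Longrightarrow> \<exists>y. N ((1 - (2 * s) *\<^sub>R z + z * z) * y) < \<epsilon> * N y" by blast
  have g: "x * x - (2 * (\<rho> * s)) *\<^sub>R x + \<rho>\<^sup>2 *\<^sub>R 1 = \<rho>\<^sup>2 *\<^sub>R (1 - (2 * s) *\<^sub>R z + z * z)"
    by (simp add: x algebra_simps power2_eq_square)
  show ?thesis
  proof (intro exI[of _ "\<rho> * s"] conjI allI impI)
    show "\<bar>\<rho> * s\<bar> \<le> \<rho>" using s pos by (simp add: abs_mult)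
    fix \<epsilon> :: real assume "\<epsilon> > 0"
    then have "\<epsilon> / \<rho>\<^sup>2 > 0" using pos by simp
    from appr[OF this] obtain y where "N ((1 - (2 * s) *\<^sub>R z + z * z) * y) < \<epsilon> / \<rho>\<^sup>2 * N y" by blast
    then show "\<exists>y. N ((x * x - (2 * (\<rho> * s)) *\<^sub>R x + \<rho>\<^sup>2 *\<^sub>R 1) * y) < \<epsilon> * N y"
      unfolding g mult_scaleR_left N_scaleR using pos by (intro exI[of _ y]) (simp add: field_simps)
  qed
qed

text \<open>Gelfand's formula with an infimum: a single exponent \<open>m\<close> whose root lies
  below \<sigma> controls all powers, by splitting off blocks \<open>x ^ m\<close>. The constant
  \<open>C\<close> absorbs the remainders below \<open>m\<close>.\<close>

lemma spectral_radius_exists: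
  "\<exists>\<rho>\<ge>0. (\<forall>n. \<rho> ^ n \<le> N (x ^ n)) \<and> (\<forall>\<sigma>>\<rho>. \<exists>C. \<forall>n. N (x ^ n) \<le> C * \<sigma> ^ n)"
proof -
  define R where "R = {root n (N (x ^ n)) | n. 0 < n}"
  define \<rho> where "\<rho> = Inf R"
  have R0: "0 \<le> r" if "r \<in> R" for r using that by (auto simp: R_def)
  have ne: "R \<noteq> {}" by (auto simp: R_def)
  have bdd: "bdd_below R" using R0 by (intro bdd_belowI)
  have \<rho>: "0 \<le> \<rho>" unfolding \<rho>_def using ne R0 by (intro cInf_greatest)
  have "\<rho> ^ n \<le> N (x ^ n)" for n
  proof (cases "n = 0")
    case False
    then have "\<rho> \<le> root n (N (x ^ n))"
      unfolding \<rho>_def by (intro cInf_lower bdd) (auto simp: R_def)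
    then have "\<rho> ^ n \<le> root n (N (x ^ n)) ^ n" using \<rho> by (intro power_mono)
    then show ?thesis using False by simp
  qed (simp add: N_one)
  moreover have "\<exists>C. \<forall>n. N (x ^ n) \<le> C * \<sigma> ^ n" if \<sigma>: "\<rho> < \<sigma>" for \<sigma>
  proof -
    have \<sigma>0: "0 < \<sigma>" using \<sigma> \<rho> by simp
    obtain m where m: "0 < m" and rm: "root m (N (x ^ m)) < \<sigma>"
      using \<sigma> cInf_lessD[OF ne] by (force simp: \<rho>_def R_def)
    have Nm: "N (x ^ m) \<le> \<sigma> ^ m"
      using power_mono[OF less_imp_le[OF rm], of m] m by simp
    define C where "C = Max ((\<lambda>j. N (x ^ j) / \<sigma> ^ j) ` {..<m})"
    have C: "N (x ^ j) \<le> C * \<sigma> ^ j" if "j < m" for j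
    proof -
      have "N (x ^ j) / \<sigma> ^ j \<le> C" unfolding C_def using that by (intro Max_ge) auto
      then show ?thesis using \<sigma>0 by (simp add: field_simps)
    qed
    have "N (x ^ n) \<le> C * \<sigma> ^ n" for n
    proof (induction n rule: less_induct)
      case (less n)
      show ?case
      proof (cases "n < m")
        case False
        then have n: "n = m + (n - m)" by simp
        have "N (x ^ m * x ^ (n - m)) \<le> \<sigma> ^ m * (C * \<sigma> ^ (n - m))"
          using less[of "n - m"] False m Nm by (intro N_mult_le) auto
        then show ?thesis using n by (metis power_add mult.left_commute)
      qed (rule C)
    qed
    then show ?thesis by blast
  qed
  ultimately show ?thesis using \<rho> by blast
qed

end

section \<open>Square seminorms on ideals\<close>

text \<open>Infinitely many exponents suffice, which matters because the square property at first
  gives only exponents that are powers of two.\<close>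

lemma le_of_power_le:
  fixes a b C :: real
  assumes "0 \<le> a" "0 \<le> b" and le: "\<And>n. \<exists>m\<ge>n. a ^ m \<le> C * b ^ m"
  shows "a \<le> b"
proof (rule ccontr)
  assume "\<not> a \<le> b"
  then have ab: "b < a" by simp
  show False
  proof (cases "b = 0")
    case True
    obtain m where "m \<ge> 1" "a ^ m \<le> C * b ^ m" using le by blast
    then show False using True ab by (simp add: power_0_left) (metis not_le zero_less_power)
  next
    case False
    then have b: "b > 0" using assms by simp
    then have gt: "1 < a / b" using ab by simp
    then obtain n where n: "C < (a / b) ^ n" using real_arch_pow by blast
    obtain m where m: "m \<ge> n" "a ^ m \<le> C * b ^ m" using le by blast
    have "(a / b) ^ n \<le> (a / b) ^ m" using m gt by (intro power_increasing) auto
    also have "\<dots> \<le> C" using m b by (simp add: power_divide field_simps)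
    finally show False using n by simp
  qed
qed

lemma power_mult_commuting:
  fixes x y :: "'u::monoid_mult"
  assumes "x * y = y * x"
  shows "(x * y) ^ n = x ^ n * y ^ n"
proof (induction n)
  case (Suc n)
  have "y * x ^ n = x ^ n * y" using assms by (metis power_commuting_commutes)
  then have "x * (y * x ^ n) * y ^ n = x * (x ^ n * y) * y ^ n" by simp
  then show ?case using Suc by (simp add: mult.assoc)
qed simp

lemma power_Suc_mult_rotate: "(u * x) ^ Suc n = u * (x * u) ^ n * x" for u x :: "'u::monoid_mult"
  by (induction n) (simp_all add: mult.assoc power_commutes)

lemma one_minus_power_factor:
  "1 - y ^ n = (\<Sum>j<n. y ^ j) * (1 - y)" for y :: "'u::ring_1"
  by (induction n) (simp_all add: algebra_simps power_commutes)

text \<open>The seminorm has no prescribed meaning on the unit, so it lives on a two-sided ideal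
  \<open>I\<close> of a unital algebra. There it is equivalent to the submultiplicative
  \<open>N\<close>, which supplies all crude product estimates.\<close>

locale square_ideal = unital_seminorm N for N :: "'u::real_algebra_1 \<Rightarrow> real" +
  fixes I :: "'u set" and p :: "'u \<Rightarrow> real" and M :: real
  assumes I_add: "x \<in> I \<Longrightarrow> y \<in> I \<Longrightarrow> x + y \<in> I"
    and I_left: "x \<in> I \<Longrightarrow> u * x \<in> I"
    and I_right: "x \<in> I \<Longrightarrow> x * u \<in> I"
    and p_nonneg: "0 \<le> p x"
    and p_add: "x \<in> I \<Longrightarrow> y \<in> I \<Longrightarrow> p (x + y) \<le> p x + p y"
    and p_scaleR: "x \<in> I \<Longrightarrow> p (c *\<^sub>R x) = \<bar>c\<bar> * p x"
    and p_square: "x \<in> I \<Longrightarrow> p (x * x) = (p x)\<^sup>2"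
    and p_le_N: "x \<in> I \<Longrightarrow> p x \<le> N x"
    and N_le_p: "x \<in> I \<Longrightarrow> N x \<le> M * p x"
    and M_nonneg: "0 \<le> M"
begin

lemma I_scaleR: "x \<in> I \<Longrightarrow> c *\<^sub>R x \<in> I"
  using I_left[of x "c *\<^sub>R 1"] by simp

lemma I_diff: "x \<in> I \<Longrightarrow> y \<in> I \<Longrightarrow> x - y \<in> I"
  using I_add[of x "- y"] I_scaleR[of y "-1"] by simp

lemma I_power: "x \<in> I \<Longrightarrow> 0 < n \<Longrightarrow> x ^ n \<in> I"
  by (cases n) (auto intro: I_right)

lemma p_power_two_power: "x \<in> I \<Longrightarrow> p (x ^ (2 ^ k)) = p x ^ (2 ^ k)"
proof (induction k)
  case (Suc k)
  have "x ^ (2 ^ Suc k) = x ^ (2 ^ k) * x ^ (2 ^ k)" by (simp add: mult_2 power_add)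
  then show ?case using Suc
    by (simp add: p_square I_power flip: power_mult) (simp add: mult.commute)
qed simp

lemma ex_power_of_two_ge: "\<exists>k. n \<le> (2::nat) ^ k"
  using less_exp[of n] less_imp_le by blast

text \<open>Commutation splits \<open>(x * y) ^ m\<close>, and for m a power of two \<open>p\<close>
  is exact on all three powers. The loss \<open>M * M\<close> disappears on comparing growth
  rates.\<close>

lemma p_mult_commuting:
  assumes x: "x \<in> I" and y: "y \<in> I" and xy: "x * y = y * x"
  shows "p (x * y) \<le> p x * p y"
proof (rule le_of_power_le)
  fix n
  obtain k where k: "n \<le> (2::nat) ^ k" using ex_power_of_two_ge by blast
  let ?m = "2 ^ k :: nat"
  have "p (x * y) ^ ?m = p ((x * y) ^ ?m)"
    using x by (simp add: p_power_two_power I_right)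
  also have "\<dots> = p (x ^ ?m * y ^ ?m)" by (simp only: power_mult_commuting[OF xy])
  also have "\<dots> \<le> N (x ^ ?m * y ^ ?m)" using x by (intro p_le_N I_right I_power) auto
  also have "\<dots> \<le> (M * p x ^ ?m) * (M * p y ^ ?m)"
    using x y N_le_p[of "x ^ ?m"] N_le_p[of "y ^ ?m"]
    by (intro N_mult_le) (auto simp: p_power_two_power I_power)
  finally have "p (x * y) ^ ?m \<le> (M * M) * (p x * p y) ^ ?m"
    by (simp add: power_mult_distrib mult_ac)
  with k show "\<exists>m\<ge>n. p (x * y) ^ m \<le> (M * M) * (p x * p y) ^ m" by blast
qed (simp_all add: p_nonneg)

lemma p_power_le:
  assumes "x \<in> I" "0 < n"
  shows "p (x ^ n) \<le> p x ^ n"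
  using assms(2)
proof (induction n rule: nat_induct_non_zero)
  case (Suc n)
  have "p (x * x ^ n) \<le> p x * p (x ^ n)"
    using assms Suc by (intro p_mult_commuting I_power) (auto simp: power_commutes)
  also have "\<dots> \<le> p x * p x ^ n" using Suc by (intro mult_left_mono) (auto simp: p_nonneg)
  finally show ?case by simp
qed simp

text \<open>For the lower bound, \<open>x ^ n\<close> is padded to a power of two, where equality is
  known, and \<open>p x ^ m\<close> is cancelled.\<close>

lemma p_power:
  assumes x: "x \<in> I" and n: "0 < n"
  shows "p (x ^ n) = p x ^ n"
proof (rule antisym[OF p_power_le[OF x n]])
  show "p x ^ n \<le> p (x ^ n)"
  proof (cases "p x = 0")
    case True
    then show ?thesis using n by (simp add: p_nonneg power_0_left)
  next
    case False
    then have pos: "p x > 0" using p_nonneg[of x] by simp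
    obtain k where k: "Suc n \<le> 2 ^ k" using ex_power_of_two_ge by blast
    define m where "m = 2 ^ k - n"
    have m: "2 ^ k = n + m" "0 < m" using k by (auto simp: m_def)
    have "p x ^ n * p x ^ m = p (x ^ n * x ^ m)"
      using p_power_two_power[OF x, of k] by (simp add: m power_add)
    also have "\<dots> \<le> p (x ^ n) * p (x ^ m)"
      using x n m by (intro p_mult_commuting I_power) (auto simp: add.commute simp flip: power_add)
    also have "\<dots> \<le> p (x ^ n) * p x ^ m"
      using x m by (intro mult_left_mono p_power_le) (auto simp: p_nonneg)
    finally show ?thesis using pos by simp
  qed
qed

lemma N_power_ge: "x \<in> I \<Longrightarrow> p x ^ n \<le> N (x ^ n)"
  using p_le_N[OF I_power[of x n]] by (cases "n = 0") (auto simp: p_power N_one)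

lemma N_power_le: "x \<in> I \<Longrightarrow> N (x ^ n) \<le> max 1 M * p x ^ n"
proof (cases "n = 0")
  case False
  assume x: "x \<in> I"
  have "N (x ^ n) \<le> M * p x ^ n" using N_le_p[OF I_power[OF x]] False by (simp add: p_power x)
  also have "\<dots> \<le> max 1 M * p x ^ n" using p_nonneg[of x] by (intro mult_right_mono) auto
  finally show ?thesis .
qed (simp add: N_one)

lemma p_rotate_le_aux:
  assumes "y \<in> I" "z \<in> I" and rot: "\<And>n. y ^ Suc n = v * z ^ n * w"
  shows "p y \<le> p z"
\<comment> \<open>The exponents on the two sides differ by one, so the general argument divides by
  \<open>p z\<close>.\<close>
proof (cases "p z = 0")
  case True
  have "y * y = v * z * w" using rot[of 1] by simp
  then have "(p y)\<^sup>2 \<le> N (v * z * w)"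
    using p_square[OF assms(1)] p_le_N[OF I_right[OF assms(1), of y]] by simp
  also have "\<dots> \<le> (N v * 0) * N w"
    using N_le_p[OF assms(2)] True by (intro N_mult_le) auto
  finally show ?thesis using p_nonneg[of y] True by simp
next
  case False
  then have pos: "p z > 0" using p_nonneg[of z] by simp
  show ?thesis
  proof (rule le_of_power_le)
    fix n
    have "p y ^ Suc n \<le> N (y ^ Suc n)" by (rule N_power_ge[OF assms(1)])
    also have "\<dots> \<le> (N v * (max 1 M * p z ^ n)) * N w"
      unfolding rot using N_power_le[OF assms(2)] by (intro N_mult_le) auto
    also have "\<dots> = (N v * max 1 M * N w / p z) * p z ^ Suc n" using pos by simp
    finally show "\<exists>m\<ge>n. p y ^ m \<le> (N v * max 1 M * N w / p z) * p z ^ m"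
      by (intro exI[of _ "Suc n"]) simp
  qed (simp_all add: p_nonneg)
qed

text \<open>Spectral radii of u x and x u agree. Here \<open>u\<close> may lie outside
  \<open>I\<close>, so conjugation by elements close to the unit is covered.\<close>

lemma p_rotate: "x \<in> I \<Longrightarrow> p (u * x) = p (x * u)"
proof (rule antisym)
  assume x: "x \<in> I"
  show "p (u * x) \<le> p (x * u)"
    by (rule p_rotate_le_aux[OF I_left[OF x] I_right[OF x] power_Suc_mult_rotate])
  show "p (x * u) \<le> p (u * x)"
    by (rule p_rotate_le_aux[OF I_right[OF x] I_left[OF x] power_Suc_mult_rotate])
qed

end

section \<open>Maximal left ideals\<close>

context unital_seminorm
begin

definition left_ideal :: "'u set \<Rightarrow> bool" where
  "left_ideal J \<longleftrightarrow> 0 \<in> J \<and> (\<forall>x\<in>J. \<forall>y\<in>J. x + y \<in> J) \<and> (\<forall>u. \<forall>x\<in>J. u * x \<in> J)"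

text \<open>The distance condition replaces \<open>1 \<notin> J\<close>: it passes to unions of
  chains, excludes dense ideals and later gives the unit quotient norm 1.\<close>

definition proper_left_ideal :: "'u set \<Rightarrow> bool" where
  "proper_left_ideal J \<longleftrightarrow> left_ideal J \<and> (\<forall>x\<in>J. 1 \<le> N (1 - x))"

lemma maximal_left_ideal_exists:
  assumes "proper_left_ideal J"
  shows "\<exists>L. J \<subseteq> L \<and> proper_left_ideal L \<and> (\<forall>K. proper_left_ideal K \<longrightarrow> L \<subseteq> K \<longrightarrow> K = L)"
proof -
  let ?P = "{K. proper_left_ideal K \<and> J \<subseteq> K}"
  have "\<exists>L\<in>?P. \<forall>K\<in>?P. L \<subseteq> K \<longrightarrow> K = L"
  proof (rule subset_Zorn_nonempty)
    show "?P \<noteq> {}" using assms by blast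
    fix c assume c: "c \<noteq> {}" "subset.chain ?P c"
    then have P: "proper_left_ideal K" "J \<subseteq> K" if "K \<in> c" for K
      using that by (auto simp: subset.chain_def)
    have "left_ideal (\<Union> c)"
      unfolding left_ideal_def
    proof (intro conjI ballI allI)
      show "0 \<in> \<Union> c" using c P by (force simp: proper_left_ideal_def left_ideal_def)
      fix x y assume "x \<in> \<Union> c" "y \<in> \<Union> c"
      then obtain K K' where K: "K \<in> c" "x \<in> K" "K' \<in> c" "y \<in> K'" by blast
      then have "K \<subseteq> K' \<or> K' \<subseteq> K" using c by (auto simp: subset_chain_def)
      then have "x + y \<in> K \<or> x + y \<in> K'"
        using K P(1) unfolding proper_left_ideal_def left_ideal_def by blast
      then show "x + y \<in> \<Union> c" using K by blast
    next
      fix u x assume "x \<in> \<Union> c"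
      then show "u * x \<in> \<Union> c" using P(1) unfolding proper_left_ideal_def left_ideal_def by blast
    qed
    then show "\<Union> c \<in> ?P" using c P unfolding proper_left_ideal_def by blast
  qed
  then obtain L where "L \<in> ?P" and max: "\<forall>K\<in>?P. L \<subseteq> K \<longrightarrow> K = L" ..
  then show ?thesis by (intro exI[of _ L]) auto
qed

end

locale maximal_left_ideal = unital_seminorm N for N :: "'u::real_algebra_1 \<Rightarrow> real" +
  fixes L :: "'u set"
  assumes proper: "proper_left_ideal L"
    and maximal: "proper_left_ideal K \<Longrightarrow> L \<subseteq> K \<Longrightarrow> K = L"
begin

lemma L_zero [simp]: "0 \<in> L"
  and L_add: "x \<in> L \<Longrightarrow> y \<in> L \<Longrightarrow> x + y \<in> L"
  and L_left: "x \<in> L \<Longrightarrow> u * x \<in> L"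
  and L_apart: "x \<in> L \<Longrightarrow> 1 \<le> N (1 - x)"
  using proper by (auto simp: proper_left_ideal_def left_ideal_def)

lemma L_scaleR: "x \<in> L \<Longrightarrow> c *\<^sub>R x \<in> L"
  using L_left[of x "c *\<^sub>R 1"] by simp

lemma L_uminus: "x \<in> L \<Longrightarrow> - x \<in> L"
  using L_scaleR[of x "-1"] by simp

lemma L_diff: "x \<in> L \<Longrightarrow> y \<in> L \<Longrightarrow> x - y \<in> L"
  using L_add[of x "- y"] L_uminus by simp

lemma L_scaleR_one_iff: "c *\<^sub>R 1 \<in> L \<longleftrightarrow> c = 0"
proof
  assume "c *\<^sub>R 1 \<in> L"
  then have "inverse c *\<^sub>R c *\<^sub>R 1 \<in> L" by (rule L_scaleR)
  then show "c = 0" using L_apart[of 1] by (cases "c = 0") auto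
qed simp

text \<open>The elements \<open>l k\<close> may be unbounded, so products are formed with bounded sequences on the left only.\<close>

definition null :: "(nat \<Rightarrow> 'u) \<Rightarrow> bool" where
  "null X \<longleftrightarrow> (\<exists>l. (\<forall>k. l k \<in> L) \<and> (\<lambda>k. N (X k - l k)) \<longlonglongrightarrow> 0)"

definition bdd :: "(nat \<Rightarrow> 'u) \<Rightarrow> bool" where
  "bdd X \<longleftrightarrow> (\<exists>C. \<forall>k. N (X k) \<le> C)"

lemma bddE:
  assumes "bdd X" obtains C where "0 \<le> C" "\<And>k. N (X k) \<le> C"
proof -
  obtain C where C: "\<And>k. N (X k) \<le> C" using assms by (auto simp: bdd_def)
  then have "0 \<le> C" using N_nonneg[of "X 0"] order_trans by blast
  with C that show ?thesis by blast
qed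

lemma bdd_const: "bdd (\<lambda>_. x)"
  by (auto simp: bdd_def)

lemma bdd_add: "bdd X \<Longrightarrow> bdd Y \<Longrightarrow> bdd (\<lambda>k. X k + Y k)"
proof (elim bddE)
  fix C D assume "\<And>k. N (X k) \<le> C" "\<And>k. N (Y k) \<le> D"
  then have "N (X k + Y k) \<le> C + D" for k by (rule order_trans[OF N_add add_mono])
  then show ?thesis by (auto simp: bdd_def)
qed

lemma bdd_diff: "bdd X \<Longrightarrow> bdd Y \<Longrightarrow> bdd (\<lambda>k. X k - Y k)"
  using bdd_add[of X "\<lambda>k. - Y k"] by (simp add: bdd_def)

lemma bdd_mult: "bdd X \<Longrightarrow> bdd Y \<Longrightarrow> bdd (\<lambda>k. X k * Y k)"
proof (elim bddE)
  fix C D assume "\<And>k. N (X k) \<le> C" "\<And>k. N (Y k) \<le> D"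
  then have "N (X k * Y k) \<le> C * D" for k by (rule N_mult_le)
  then show ?thesis by (auto simp: bdd_def)
qed

lemma bdd_scaleR: "bdd X \<Longrightarrow> bdd (\<lambda>k. c *\<^sub>R X k)"
  using bdd_mult[OF bdd_const[of "c *\<^sub>R 1"]] by simp

lemma bdd_power: "bdd X \<Longrightarrow> bdd (\<lambda>k. X k ^ n)"
  by (induction n) (auto intro: bdd_const bdd_mult)

lemmas bdd_intros = bdd_const bdd_add bdd_diff bdd_mult bdd_scaleR bdd_power

lemma null_L: "(\<And>k. X k \<in> L) \<Longrightarrow> null X"
  unfolding null_def by (intro exI[of _ X]) simp

lemma null_limit: "(\<lambda>k. N (X k)) \<longlonglongrightarrow> 0 \<Longrightarrow> null X"
  unfolding null_def by (intro exI[of _ "\<lambda>_. 0"]) simp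

lemma null_add:
  assumes "null X" "null Y" shows "null (\<lambda>k. X k + Y k)"
proof -
  obtain l l' where l: "\<And>k. l k \<in> L" "(\<lambda>k. N (X k - l k)) \<longlonglongrightarrow> 0"
    and l': "\<And>k. l' k \<in> L" "(\<lambda>k. N (Y k - l' k)) \<longlonglongrightarrow> 0"
    using assms unfolding null_def by blast
  have "(\<lambda>k. N (X k + Y k - (l k + l' k))) \<longlonglongrightarrow> 0"
  proof (rule tendsto_0_le[where K = 1])
    show "(\<lambda>k. N (X k - l k) + N (Y k - l' k)) \<longlonglongrightarrow> 0"
      using tendsto_add[OF l(2) l'(2)] by simp
    have "N (X k + Y k - (l k + l' k)) \<le> N (X k - l k) + N (Y k - l' k)" for k
      using N_add[of "X k - l k" "Y k - l' k"] by (simp add: algebra_simps)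
    then show "\<forall>\<^sub>F k in sequentially. norm (N (X k + Y k - (l k + l' k)))
        \<le> norm (N (X k - l k) + N (Y k - l' k)) * 1"
      by (intro always_eventually allI) simp
  qed
  then show ?thesis
    unfolding null_def using l(1) l'(1) by (intro exI[of _ "\<lambda>k. l k + l' k"]) (simp add: L_add)
qed

lemma null_mult:
  assumes "bdd U" "null X" shows "null (\<lambda>k. U k * X k)"
proof -
  obtain l where l: "\<And>k. l k \<in> L" "(\<lambda>k. N (X k - l k)) \<longlonglongrightarrow> 0"
    using assms unfolding null_def by blast
  obtain C where C: "0 \<le> C" "\<And>k. N (U k) \<le> C" using bddE[OF assms(1)] by blast
  have "(\<lambda>k. N (U k * X k - U k * l k)) \<longlonglongrightarrow> 0"
  proof (rule tendsto_0_le[OF l(2), where K = C])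
    have "N (U k * (X k - l k)) \<le> C * N (X k - l k)" for k
      using C by (intro N_mult_le) auto
    then show "\<forall>\<^sub>F k in sequentially. norm (N (U k * X k - U k * l k)) \<le> norm (N (X k - l k)) * C"
      by (intro always_eventually allI) (simp add: right_diff_distrib mult.commute)
  qed
  then show ?thesis
    unfolding null_def using l(1) by (intro exI[of _ "\<lambda>k. U k * l k"]) (simp add: L_left)
qed

lemma null_scaleR: "null X \<Longrightarrow> null (\<lambda>k. c *\<^sub>R X k)"
  using null_mult[OF bdd_const[of "c *\<^sub>R 1"]] by simp

lemma null_uminus: "null X \<Longrightarrow> null (\<lambda>k. - X k)"
  using null_scaleR[of X "-1"] by simp

lemma null_power_minus_one:
  assumes "bdd X" "null (\<lambda>k. X k - 1)"
  shows "null (\<lambda>k. X k ^ n - 1)"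
proof (induction n)
  case (Suc n)
  have "X k ^ Suc n - 1 = X k * (X k ^ n - 1) + (X k - 1)" for k by (simp add: algebra_simps)
  then show ?case by (simp only:) (intro null_add null_mult Suc assms)
qed (simp add: null_L)

lemma null_power_eigen:
  assumes "bdd X" "null (\<lambda>k. X k * u - c *\<^sub>R u)"
  shows "null (\<lambda>k. X k ^ n * u - c ^ n *\<^sub>R u)"
proof (induction n)
  case (Suc n)
  have "X k ^ Suc n * u - c ^ Suc n *\<^sub>R u
      = X k * (X k ^ n * u - c ^ n *\<^sub>R u) + c ^ n *\<^sub>R (X k * u - c *\<^sub>R u)" for k
    by (simp add: algebra_simps)
  then show ?case by (simp only:) (intro null_add null_mult null_scaleR Suc assms)
qed (simp add: null_L)

lemma L_power_minus_one: "x - 1 \<in> L \<Longrightarrow> x ^ n - 1 \<in> L"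
proof (induction n)
  case (Suc n)
  have "x ^ Suc n - 1 = x * (x ^ n - 1) + (x - 1)" by (simp add: algebra_simps)
  then show ?case using Suc by (simp only: L_add L_left)
qed simp

text \<open>The source of the contradictions below: \<open>L\<close> keeps distance at least 1 from
  the unit, so a sequence of norms at most \<open>c < 1\<close> cannot represent 1.\<close>

lemma not_null_one_minus:
  assumes "null (\<lambda>k. 1 - X k)" and c: "c < 1" "\<And>k. N (X k) \<le> c"
  shows False
proof -
  obtain l where l: "\<And>k. l k \<in> L" "(\<lambda>k. N (1 - X k - l k)) \<longlonglongrightarrow> 0"
    using assms unfolding null_def by blast
  have "\<forall>\<^sub>F k in sequentially. N (1 - X k - l k) < 1 - c"
    using c by (intro order_tendstoD(2)[OF l(2)]) simp
  then obtain k where k: "N (1 - X k - l k) < 1 - c" by (auto simp: eventually_sequentially)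
  have "N (1 - l k) \<le> N (X k) + N (1 - X k - l k)"
    using N_add[of "X k" "1 - X k - l k"] by (simp add: algebra_simps)
  also have "\<dots> < 1" using k c(2)[of k] by simp
  finally show False using L_apart[OF l(1)[of k]] by simp
qed

text \<open>\<open>J\<close> strictly contains \<open>L\<close>, so by maximality some
  \<open>b * z + l\<close> is at distance less than 1 from the unit. Partial sums of the Neumann
  series invert it up to \<open>y ^ k\<close>; multiplied by \<open>b\<close> they stay in the left
  ideal \<open>B\<close>.\<close>

lemma approximate_left_inverse:
  assumes B: "left_ideal B" and i: "i \<in> B" "i * z \<notin> L"
  shows "\<exists>b. bdd b \<and> (\<forall>k. b k \<in> B) \<and> null (\<lambda>k. 1 - b k * z)"
proof -
  define J where "J = {b * z + l | b l. b \<in> B \<and> l \<in> L}"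
  have B0: "0 \<in> B" and B_add: "\<And>x y. x \<in> B \<Longrightarrow> y \<in> B \<Longrightarrow> x + y \<in> B"
    and B_left: "\<And>u x. x \<in> B \<Longrightarrow> u * x \<in> B"
    using B by (auto simp: left_ideal_def)
  have J: "b * z + l \<in> J" if "b \<in> B" "l \<in> L" for b l
    using that by (auto simp: J_def)
  have "left_ideal J"
    unfolding left_ideal_def
  proof (intro conjI ballI allI)
    show "0 \<in> J" using J[OF B0 L_zero] by simp
    fix x y assume "x \<in> J" "y \<in> J"
    then obtain b l b' l' where *: "x = b * z + l" "b \<in> B" "l \<in> L" "y = b' * z + l'" "b' \<in> B" "l' \<in> L"
      by (auto simp: J_def)
    have "x + y = (b + b') * z + (l + l')" by (simp add: * algebra_simps)
    then show "x + y \<in> J" using * by (simp only: J B_add L_add)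
  next
    fix u x assume "x \<in> J"
    then obtain b l where *: "x = b * z + l" "b \<in> B" "l \<in> L" by (auto simp: J_def)
    have "u * x = (u * b) * z + u * l" by (simp add: * algebra_simps)
    then show "u * x \<in> J" using * by (simp only: J B_left L_left)
  qed
  moreover have "L \<subseteq> J" using J[OF B0] by auto
  moreover have "i * z \<in> J" using J[OF i(1) L_zero] by simp
  ultimately have "\<not> proper_left_ideal J" using maximal i by blast
  then obtain x where "x \<in> J" "N (1 - x) < 1"
    using \<open>left_ideal J\<close> unfolding proper_left_ideal_def by (meson not_le)
  then obtain b l where b: "b \<in> B" and l: "l \<in> L" and y1: "N (1 - (b * z + l)) < 1"
    unfolding J_def by blast
  define y where "y = 1 - (b * z + l)"
  define S where "S = (\<lambda>k. \<Sum>j<k. y ^ j)"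
  have y: "N y < 1" using y1 by (simp add: y_def)
  have "N (S k) \<le> 1 / (1 - N y)" for k
  proof -
    have "N (S k) \<le> (\<Sum>j<k. N y ^ j)"
      unfolding S_def by (intro order_trans[OF N_sum] sum_mono N_power)
    also have "\<dots> \<le> (\<Sum>j. N y ^ j)"
      using y by (intro sum_le_suminf summable_geometric) auto
    also have "\<dots> = 1 / (1 - N y)" using y by (intro suminf_geometric) simp
    finally show ?thesis .
  qed
  then have S: "bdd S" unfolding bdd_def by blast
  have "1 - S k * b * z = y ^ k + S k * l" for k
  proof -
    have "1 - y ^ k = S k * (b * z + l)"
      unfolding S_def by (simp only: one_minus_power_factor y_def diff_diff_eq2 add_diff_cancel_left')
    then show ?thesis by (simp add: algebra_simps)
  qed
  moreover have "null (\<lambda>k. y ^ k + S k * l)"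
  proof (intro null_add[OF null_limit null_L] L_left l)
    show "(\<lambda>k. N (y ^ k)) \<longlonglongrightarrow> 0"
      by (rule tendsto_0_le[OF LIMSEQ_realpow_zero[of "N y"], where K = 1])
        (use y N_power in \<open>auto intro!: always_eventually\<close>)
  qed
  ultimately show ?thesis
    using b B S by (intro exI[of _ "\<lambda>k. S k * b"]) (auto intro: bdd_intros simp: left_ideal_def)
qed

lemma left_inverse_mod:
  assumes "z \<notin> L"
  shows "\<exists>b. bdd b \<and> null (\<lambda>k. 1 - b k * z)"
proof -
  have "left_ideal UNIV" by (simp add: left_ideal_def)
  from approximate_left_inverse[OF this, of 1 z] assms show ?thesis by auto
qed

text \<open>In other words \<open>L\<close> is closed: an element of the closure outside
  \<open>L\<close> would have an approximate left inverse, making the unit null.\<close>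

lemma null_const_imp_mem:
  assumes "null (\<lambda>_. x)" shows "x \<in> L"
proof (rule ccontr)
  assume "x \<notin> L"
  then obtain b where b: "bdd b" "null (\<lambda>k. 1 - b k * x)" using left_inverse_mod by blast
  have "null (\<lambda>k. (1 - b k * x) + b k * x)" by (intro null_add null_mult b assms)
  then have "null (\<lambda>k. 1 - 0)" by simp
  then show False by (rule not_null_one_minus[of _ 0]) auto
qed

end

section \<open>Two-sidedness of the maximal left ideal\<close>

locale square_maximal = square_ideal N I p M + maximal_left_ideal N L
  for N :: "'u::real_algebra_1 \<Rightarrow> real" and I p M L +
  assumes I_not_subset: "\<not> I \<subseteq> L"
begin

lemma left_ideal_I: "left_ideal I"
proof -
  obtain i where "i \<in> I" using I_not_subset by blast
  then have "0 \<in> I" using I_left[of i 0] by simp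
  then show ?thesis by (auto simp: left_ideal_def I_add I_left)
qed

text \<open>The inverses are wanted in \<open>I\<close> because only there does \<open>p\<close>
  control norms. If \<open>I\<close> times \<open>z\<close> were inside \<open>L\<close>, then each
  i in \<open>I\<close> would be the limit of \<open>i * b k * z\<close> modulo \<open>L\<close>,
  hence in \<open>L\<close>.\<close>

lemma left_inverse_in_ideal:
  assumes "z \<notin> L"
  shows "\<exists>b. bdd b \<and> (\<forall>k. b k \<in> I) \<and> null (\<lambda>k. 1 - b k * z)"
proof -
  have "\<exists>i\<in>I. i * z \<notin> L"
  proof (rule ccontr)
    assume neg: "\<not> ?thesis"
    obtain b where b: "bdd b" "null (\<lambda>k. 1 - b k * z)" using left_inverse_mod assms by blast
    have "i \<in> L" if "i \<in> I" for i
    proof (rule null_const_imp_mem)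
      have "i * b k * z \<in> L" for k using that neg I_right by blast
      then have "null (\<lambda>k. i * (1 - b k * z) + i * b k * z)"
        by (intro null_add[OF null_mult null_L] bdd_const b)
      then show "null (\<lambda>_. i)" by (simp add: right_diff_distrib mult.assoc)
    qed
    then show False using I_not_subset by blast
  qed
  then obtain i where i: "i \<in> I" "i * z \<notin> L" by blast
  show ?thesis by (rule approximate_left_inverse[OF left_ideal_I i])
qed

text \<open>The factors imitate exp (t a) and exp (-t a); their product is the n-th power of 1 -
  (t/n)^2 a^2, of norm at most exp (x/n). One \<open>n\<close> serves all \<open>a\<close> with
  \<open>N a \<le> C\<close>, hence a whole bounded sequence.\<close>

lemma scaled_inverse_pair_norm:
  assumes C: "0 \<le> C"
  shows "\<exists>n>0. \<forall>a. N a \<le> C \<longrightarrow>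
    N ((1 + (t / real n) *\<^sub>R a) ^ n * (1 - (t / real n) *\<^sub>R a) ^ n) \<le> 2"
proof -
  define x where "x = (t * C)\<^sup>2"
  obtain n :: nat where n: "real n > max 1 (x / ln 2)" using reals_Archimedean2 by blast
  then have n0: "0 < real n" and xn: "x / real n \<le> ln 2" by (auto simp: field_simps)
  have "N ((1 + (t / real n) *\<^sub>R a) ^ n * (1 - (t / real n) *\<^sub>R a) ^ n) \<le> 2" if a: "N a \<le> C" for a
  proof -
    define \<tau> where "\<tau> = t / real n"
    have "(1 + \<tau> *\<^sub>R a) * (1 - \<tau> *\<^sub>R a) = 1 - \<tau>\<^sup>2 *\<^sub>R (a * a)"
      and "(1 - \<tau> *\<^sub>R a) * (1 + \<tau> *\<^sub>R a) = 1 - \<tau>\<^sup>2 *\<^sub>R (a * a)"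
      by (simp_all add: algebra_simps power2_eq_square)
    then have eq: "(1 + \<tau> *\<^sub>R a) ^ n * (1 - \<tau> *\<^sub>R a) ^ n = (1 - \<tau>\<^sup>2 *\<^sub>R (a * a)) ^ n"
      by (metis power_mult_commuting)
    have "N (1 - \<tau>\<^sup>2 *\<^sub>R (a * a)) \<le> N 1 + N (\<tau>\<^sup>2 *\<^sub>R (a * a))" by (rule N_diff)
    also have "\<dots> = 1 + \<tau>\<^sup>2 * N (a * a)" by (simp add: N_one N_scaleR)
    also have "\<dots> \<le> 1 + \<tau>\<^sup>2 * (C * C)"
      using N_mult_le[OF a a] by (intro add_left_mono mult_left_mono) auto
    also have "\<dots> = 1 + x / real n / real n"
      by (simp add: \<tau>_def x_def power2_eq_square)
    also have "\<dots> \<le> exp (x / real n / real n)" by simp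
    finally have "N (1 - \<tau>\<^sup>2 *\<^sub>R (a * a)) ^ n \<le> exp (x / real n / real n) ^ n"
      by (intro power_mono) auto
    also have "\<dots> = exp (x / real n)" using n0 by (simp flip: exp_of_nat_mult)
    also have "\<dots> \<le> exp (ln 2)" using xn by (simp only: exp_le_cancel_iff)
    finally have "N (1 - \<tau>\<^sup>2 *\<^sub>R (a * a)) ^ n \<le> 2" by simp
    then show ?thesis using N_power order_trans by (simp only: eq flip: \<tau>_def) blast
  qed
  then show ?thesis using n0 by auto
qed

text \<open>If \<open>l \<in> L\<close> and \<open>l * u \<notin> L\<close>, then modulo \<open>L\<close> the element \<open>E = b * l\<close>, for a suitable \<open>b\<close>, and
  the element \<open>f = u - u * u * E\<close> act on the span of \<open>1\<close> and \<open>u\<close> as the two nilpotent matrix units.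
  Conjugation by \<open>exp (t * u * E)\<close> multiplies \<open>E\<close> by a large factor there but does not change
  \<open>p E\<close>, so the eigenvalues of \<open>f + E\<close> would violate the subadditivity of \<open>p\<close>. The exponential is
  replaced by \<open>(1 + t/n * u * E) ^ n\<close>.\<close>

lemma L_right_in_ideal:
  assumes l: "l \<in> L" and u: "u \<in> I"
  shows "l * u \<in> L"
proof (rule ccontr)
  assume "l * u \<notin> L"
  then obtain b where b: "bdd b" "\<And>k. b k \<in> I" "null (\<lambda>k. 1 - b k * (l * u))"
    using left_inverse_in_ideal by blast
  \<comment> \<open>Acting from the left modulo \<open>L\<close> and null sequences,
    \<open>E\<close> sends 1 to 0 and u to 1, \<open>f\<close> sends 1 to u and u to 0, and
    \<open>a\<close> sends 1 to 0 and fixes u.\<close>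
  define E where "E = (\<lambda>k. b k * l)"
  define f where "f = (\<lambda>k. u - u * u * E k)"
  define a where "a = (\<lambda>k. u * E k)"
  have E_I: "E k \<in> I" and E_L: "E k \<in> L" for k by (auto simp: E_def b I_right L_left l)
  have f_I: "f k \<in> I" for k by (auto simp: f_def u I_diff I_left E_I)
  have a_L: "a k \<in> L" for k by (auto simp: a_def L_left E_L)
  have bE: "bdd E" unfolding E_def by (intro bdd_intros b)
  have bf: "bdd f" unfolding f_def by (intro bdd_intros bE)
  have ba: "bdd a" unfolding a_def by (intro bdd_intros bE)
  obtain Ce where Ce: "0 \<le> Ce" "\<And>k. N (E k) \<le> Ce" using bddE[OF bE] by blast
  obtain Cf where Cf: "0 \<le> Cf" "\<And>k. N (f k) \<le> Cf" using bddE[OF bf] by blast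
  obtain Ca where Ca: "0 \<le> Ca" "\<And>k. N (a k) \<le> Ca" using bddE[OF ba] by blast
  have Eu: "null (\<lambda>k. E k * u - 1)"
    using null_uminus[OF b(3)] by (simp add: E_def mult.assoc)
  have fu: "null (\<lambda>k. f k * u)"
  proof -
    have "f k * u = (- (u * u)) * (E k * u - 1)" for k by (simp add: f_def algebra_simps)
    then show ?thesis by (simp only:) (intro null_mult bdd_const Eu)
  qed
  \<comment> \<open>\<open>R\<close> will bound \<open>p\<close> of \<open>f k + G k\<close>
    whatever \<open>t\<close> is, the factor 2 coming from \<open>pair\<close>. The choice of
    \<open>t\<close> then makes the eigenvalue \<open>s\<close> exceed
    \<open>4 * R\<^sup>2\<close>.\<close>
  define R where "R = Cf + Ce * 2"
  define t where "t = 4 * R\<^sup>2"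
  obtain n where n: "0 < n"
    and pair: "\<And>k. N ((1 + (t / real n) *\<^sub>R a k) ^ n * (1 - (t / real n) *\<^sub>R a k) ^ n) \<le> 2"
    using scaled_inverse_pair_norm[OF Ca(1), of t] Ca(2) by blast
  define \<tau> where "\<tau> = t / real n"
  define s where "s = (1 + \<tau>) ^ n"
  have \<tau>: "0 \<le> \<tau>" by (simp add: \<tau>_def t_def)
  have "1 + real n * \<tau> \<le> s" unfolding s_def using \<tau> by (intro Bernoulli_inequality) simp
  then have s: "1 + t \<le> s" using n by (simp add: \<tau>_def)
  moreover have "0 \<le> t" by (simp add: t_def)
  ultimately have s0: "0 < s" by simp
  define h where "h = (\<lambda>k. (1 + \<tau> *\<^sub>R a k) ^ n)"
  define h' where "h' = (\<lambda>k. (1 - \<tau> *\<^sub>R a k) ^ n)"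
  have bh: "bdd h" "bdd h'" unfolding h_def h'_def by (intro bdd_intros ba)+
  have h_L: "h k - 1 \<in> L" and h'_L: "h' k - 1 \<in> L" for k
    unfolding h_def h'_def using L_scaleR[OF a_L[of k]] L_uminus
    by (auto intro!: L_power_minus_one)
  \<comment> \<open>An approximate conjugate of \<open>E\<close>, sending 1 to 0 and u to
    \<open>s\<close>. After rotation only the product of \<open>h\<close> and \<open>h'\<close>
    enters the bound on \<open>p\<close>, not their separate and possibly large norms.\<close>
  define G where "G = (\<lambda>k. h' k * (E k * h k))"
  have bG: "bdd G" unfolding G_def by (intro bdd_intros bE bh)
  have G_I: "G k \<in> I" for k by (auto simp: G_def I_left I_right E_I)
  have G_L: "G k \<in> L" for k
  proof -
    have "G k = h' k * E k * (h k - 1) + h' k * E k" by (simp add: G_def algebra_simps)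
    then show ?thesis by (simp only: L_add L_left h_L E_L)
  qed
  have pG: "p (G k) \<le> Ce * 2" for k
  proof -
    have "p (G k) = p (E k * h k * h' k)" unfolding G_def by (rule p_rotate) (simp add: I_right E_I)
    also have "\<dots> \<le> N (E k * (h k * h' k))"
      by (simp add: mult.assoc I_right E_I p_le_N)
    also have "\<dots> \<le> Ce * 2" using pair Ce unfolding h_def h'_def \<tau>_def by (intro N_mult_le) auto
    finally show ?thesis .
  qed
  have hu: "null (\<lambda>k. h k * u - s *\<^sub>R u)"
    unfolding h_def s_def
  proof (rule null_power_eigen)
    show "bdd (\<lambda>k. 1 + \<tau> *\<^sub>R a k)" by (intro bdd_intros ba)
    have "(1 + \<tau> *\<^sub>R a k) * u - (1 + \<tau>) *\<^sub>R u = (\<tau> *\<^sub>R u) * (E k * u - 1)" for k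
      by (simp add: a_def algebra_simps)
    then show "null (\<lambda>k. (1 + \<tau> *\<^sub>R a k) * u - (1 + \<tau>) *\<^sub>R u)"
      by (simp only:) (intro null_mult bdd_const Eu)
  qed
  have Gu: "null (\<lambda>k. G k * u - s *\<^sub>R 1)"
  proof -
    have "G k * u - s *\<^sub>R 1 = h' k * E k * (h k * u - s *\<^sub>R u) + (s *\<^sub>R h' k) * (E k * u - 1)
        + s *\<^sub>R (h' k - 1)" for k
      by (simp add: G_def algebra_simps)
    then show ?thesis
      by (simp only:) (intro null_add null_mult null_L L_scaleR bdd_intros hu Eu h'_L bh bE)
  qed
  \<comment> \<open>\<open>y\<close> sends 1 to u and u to \<open>s\<close>, so \<open>y * y\<close>
    represents the scalar \<open>s\<close>, although \<open>p (y k)\<close> is at most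
    \<open>R\<close>.\<close>
  define y where "y = (\<lambda>k. f k + G k)"
  have by': "bdd y" unfolding y_def by (intro bdd_intros bf bG)
  have y_I: "y k \<in> I" for k by (simp add: y_def I_add f_I G_I)
  have py: "p (y k) \<le> R" for k
  proof -
    have "p (y k) \<le> p (f k) + p (G k)" unfolding y_def by (intro p_add f_I G_I)
    also have "\<dots> \<le> Cf + Ce * 2" using p_le_N[OF f_I[of k]] Cf(2)[of k] pG[of k] by linarith
    finally show ?thesis by (simp add: R_def)
  qed
  have yy: "null (\<lambda>k. y k * y k - s *\<^sub>R 1)"
  proof -
    have "y k * y k - s *\<^sub>R 1 = y k * ((- (u * u)) * E k + G k) + (f k * u + (G k * u - s *\<^sub>R 1))" for k
      by (simp add: y_def f_def algebra_simps)
    then show ?thesis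
      by (simp only:) (intro null_add null_mult null_L L_add L_left by' fu Gu E_L G_L)
  qed
  define g where "g = (\<lambda>k. inverse s *\<^sub>R (y k * y k))"
  have bg: "bdd g" unfolding g_def by (intro bdd_intros by')
  have g_I: "g k \<in> I" for k by (simp add: g_def I_scaleR I_left y_I)
  have g1: "null (\<lambda>k. g k - 1)"
  proof -
    have "g k - 1 = inverse s *\<^sub>R (y k * y k - s *\<^sub>R 1)" for k
      using s0 by (simp add: g_def algebra_simps)
    then show ?thesis by (simp only:) (intro null_scaleR yy)
  qed
  have pg: "p (g k) \<le> 1 / 4" for k
  proof -
    have "p (g k) = inverse s * (p (y k))\<^sup>2" using s0 by (simp add: g_def p_scaleR I_left y_I p_square)
    also have "\<dots> \<le> inverse s * R\<^sup>2"
      using s0 py p_nonneg by (intro mult_left_mono power_mono) auto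
    also have "\<dots> \<le> 1 / 4" using s s0 by (simp add: t_def field_simps)
    finally show ?thesis .
  qed
  \<comment> \<open>A high power of \<open>g\<close> still represents 1, while its \<open>N\<close>
    falls below 1 in spite of the factor \<open>M\<close>.\<close>
  obtain m where "(1 / 4 :: real) ^ m < 1 / (2 * max 1 M)"
    using real_arch_pow_inv[of "1 / (2 * max 1 M)" "1 / 4"] by auto
  then have m: "max 1 M * (1 / 4) ^ m < 1 / 2" by (simp add: field_simps)
  have "null (\<lambda>k. 1 - g k ^ m)"
    using null_uminus[OF null_power_minus_one[OF bg g1, of m]] by simp
  then show False
  proof (rule not_null_one_minus)
    show "(1/2::real) < 1" by simp
    fix k
    have "N (g k ^ m) \<le> max 1 M * p (g k) ^ m" by (rule N_power_le[OF g_I])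
    also have "\<dots> \<le> max 1 M * (1 / 4) ^ m"
      using pg p_nonneg by (intro mult_left_mono power_mono) auto
    finally show "N (g k ^ m) \<le> 1 / 2" using m by simp
  qed
qed

text \<open>Modulo \<open>L\<close> the unit is approximated by elements \<open>b k\<close> of
  \<open>I\<close>, and \<open>u * b k\<close> lies in \<open>I\<close>, where the previous lemma
  applies.\<close>

lemma L_right: "l \<in> L \<Longrightarrow> l * u \<in> L"
proof (rule null_const_imp_mem)
  assume l: "l \<in> L"
  have "1 \<notin> L" using L_scaleR_one_iff[of 1] by simp
  then obtain b where b: "bdd b" "\<And>k. b k \<in> I" "null (\<lambda>k. 1 - b k * 1)"
    using left_inverse_in_ideal by blast
  have "null (\<lambda>k. (l * u) * (1 - b k * 1) + l * (u * b k))"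
    by (intro null_add[OF null_mult null_L] bdd_const b L_right_in_ideal l I_left)
  then show "null (\<lambda>_. l * u)" by (simp add: algebra_simps)
qed

section \<open>The quotient\<close>

definition Nq :: "'u \<Rightarrow> real" where
  "Nq x = (INF l\<in>L. N (x - l))"

lemma Nq_le: "l \<in> L \<Longrightarrow> Nq x \<le> N (x - l)"
  unfolding Nq_def by (intro cINF_lower bdd_belowI2[of _ 0]) auto

lemma Nq_le_N: "Nq x \<le> N x"
  using Nq_le[OF L_zero] by simp

lemma Nq_greatest: "(\<And>l. l \<in> L \<Longrightarrow> c \<le> N (x - l)) \<Longrightarrow> c \<le> Nq x"
proof -
  have "L \<noteq> {}" using L_zero by blast
  then show "(\<And>l. l \<in> L \<Longrightarrow> c \<le> N (x - l)) \<Longrightarrow> c \<le> Nq x"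
    unfolding Nq_def by (rule cINF_greatest)
qed

lemma Nq_nonneg: "0 \<le> Nq x"
  by (intro Nq_greatest) simp

lemma le_mult_Nq:
  assumes "0 \<le> c" and le: "\<And>l. l \<in> L \<Longrightarrow> r \<le> c * N (x - l)"
  shows "r \<le> c * Nq x"
proof (cases "c = 0")
  case True
  then show ?thesis using le[OF L_zero] by simp
next
  case False
  then have "r / c \<le> Nq x"
    using assms by (intro Nq_greatest) (simp add: field_simps)
  then show ?thesis using False assms by (simp add: field_simps)
qed

text \<open>Submultiplicativity rests on \<open>L_right\<close>, since \<open>l * y\<close> must
  stay in \<open>L\<close>; the value 1 at the unit is the distance condition on
  \<open>L\<close>.\<close>

lemma quotient_seminorm: "unital_seminorm Nq"
proof
  fix x y :: 'u and c :: real
  have "Nq (x + y) - N (y - m) \<le> Nq x" if m: "m \<in> L" for m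
  proof (rule Nq_greatest)
    fix l assume "l \<in> L"
    with m have "Nq (x + y) \<le> N ((x - l) + (y - m))"
      using Nq_le[of "l + m" "x + y"] by (simp add: L_add algebra_simps)
    also have "\<dots> \<le> N (x - l) + N (y - m)" by (rule N_add)
    finally show "Nq (x + y) - N (y - m) \<le> N (x - l)" by simp
  qed
  then have "Nq (x + y) - Nq x \<le> Nq y"
    by (intro Nq_greatest) (simp add: algebra_simps)
  then show "Nq (x + y) \<le> Nq x + Nq y" by simp
  have scale: "Nq (c *\<^sub>R x) \<le> \<bar>c\<bar> * Nq x" for c x
  proof (rule le_mult_Nq)
    fix l assume "l \<in> L"
    then have "Nq (c *\<^sub>R x) \<le> N (c *\<^sub>R x - c *\<^sub>R l)" by (intro Nq_le L_scaleR)
    then show "Nq (c *\<^sub>R x) \<le> \<bar>c\<bar> * N (x - l)" by (simp add: N_scaleR flip: scaleR_diff_right)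
  qed simp
  show "Nq (c *\<^sub>R x) = \<bar>c\<bar> * Nq x"
  proof (cases "c = 0")
    case True
    then show ?thesis using scale[of 0 x] Nq_nonneg[of 0] by simp
  next
    case False
    then have "Nq x \<le> \<bar>inverse c\<bar> * Nq (c *\<^sub>R x)" using scale[of "inverse c" "c *\<^sub>R x"] by simp
    then show ?thesis using scale[of c x] False by (simp add: field_simps abs_inverse)
  qed
  show "Nq 1 = 1"
    using Nq_le_N[of 1] Nq_greatest[of 1 1] L_apart by (simp add: N_one)
  have "Nq (x * y) \<le> N (y - m) * Nq x" if m: "m \<in> L" for m
  proof (rule le_mult_Nq)
    fix l assume l: "l \<in> L"
    have "(x - l) * (y - m) = x * y - (l * y + (x - l) * m)" by (simp add: algebra_simps)
    moreover have "l * y + (x - l) * m \<in> L" using l m by (simp only: L_add L_left L_right)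
    ultimately have "Nq (x * y) \<le> N ((x - l) * (y - m))" using Nq_le by simp
    also have "\<dots> \<le> N (x - l) * N (y - m)" by (rule N_mult)
    finally show "Nq (x * y) \<le> N (y - m) * N (x - l)" by (simp add: mult.commute)
  qed simp
  then have "Nq (x * y) \<le> Nq x * Nq y"
    by (intro le_mult_Nq Nq_nonneg) (simp add: mult.commute)
  then show "Nq (x * y) \<le> Nq x * Nq y" .
qed

text \<open>Gelfand--Mazur for the quotient: an approximate root of a quadratic polynomial of \<open>x\<close> in
  the quotient is a right zero divisor up to small errors, so that polynomial lies in \<open>L\<close>.\<close>

lemma quadratic_mod_L:
  "\<exists>s \<rho>. 0 \<le> \<rho> \<and> \<bar>s\<bar> \<le> \<rho> \<and> x * x - (2 * s) *\<^sub>R x + \<rho>\<^sup>2 *\<^sub>R 1 \<in> L \<and> (\<forall>n. \<rho> ^ n \<le> N (x ^ n))"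
proof -
  interpret Q: unital_seminorm Nq by (rule quotient_seminorm)
  obtain \<rho> where \<rho>: "0 \<le> \<rho>" "\<And>n. \<rho> ^ n \<le> Nq (x ^ n)"
    and "\<And>\<sigma>. \<rho> < \<sigma> \<Longrightarrow> \<exists>C. \<forall>n. Nq (x ^ n) \<le> C * \<sigma> ^ n"
    using Q.spectral_radius_exists[of x] by blast
  from Q.approximate_root[OF this] obtain s where s: "\<bar>s\<bar> \<le> \<rho>"
    and root: "\<forall>\<epsilon>>0. \<exists>y. Nq ((x * x - (2 * s) *\<^sub>R x + \<rho>\<^sup>2 *\<^sub>R 1) * y) < \<epsilon> * Nq y"
    by blast
  define g where "g = x * x - (2 * s) *\<^sub>R x + \<rho>\<^sup>2 *\<^sub>R 1"
  have "g \<in> L"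
  proof (rule ccontr)
    assume "g \<notin> L"
    then obtain b where "null (\<lambda>k. 1 - b k * g)" using left_inverse_mod by blast
    then obtain l where l: "\<And>k. l k \<in> L" "(\<lambda>k. N (1 - b k * g - l k)) \<longlonglongrightarrow> 0"
      unfolding null_def by blast
    have "\<forall>\<^sub>F k in sequentially. N (1 - b k * g - l k) < 1 / 2"
      by (intro order_tendstoD(2)[OF l(2)]) simp
    then obtain k where "N (1 - b k * g - l k) < 1 / 2" by (auto simp: eventually_sequentially)
    then have small: "Nq (1 - b k * g) \<le> 1 / 2" using Nq_le[OF l(1)[of k], of "1 - b k * g"] by simp
    \<comment> \<open>The summand 1 avoids division by zero and makes
      \<open>Nq (b k) * \<epsilon>\<close> strictly less than 1/2.\<close>
    define \<epsilon> where "\<epsilon> = 1 / (2 * (Nq (b k) + 1))"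
    have "0 < Nq (b k) + 1" using Nq_nonneg[of "b k"] by linarith
    then have "0 < \<epsilon>" and half: "(Nq (b k) + 1) * \<epsilon> = 1 / 2" by (simp_all add: \<epsilon>_def)
    from root \<open>0 < \<epsilon>\<close> obtain y where y: "Nq (g * y) < \<epsilon> * Nq y" unfolding g_def by blast
    have "Nq y = Nq ((1 - b k * g) * y + b k * (g * y))" by (simp add: algebra_simps)
    also have "\<dots> \<le> Nq ((1 - b k * g) * y) + Nq (b k * (g * y))" by (rule Q.N_add)
    also have "\<dots> \<le> 1 / 2 * Nq y + Nq (b k) * (\<epsilon> * Nq y)"
      by (rule add_mono[OF Q.N_mult_le[OF small order_refl] Q.N_mult_le[OF order_refl less_imp_le[OF y]]])
    also have "\<dots> = (1 / 2 + Nq (b k) * \<epsilon>) * Nq y" by (simp add: algebra_simps)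
    finally have "Nq y \<le> (1 / 2 + Nq (b k) * \<epsilon>) * Nq y" .
    moreover have "1 / 2 + Nq (b k) * \<epsilon> < 1"
      using half \<open>0 < \<epsilon>\<close> by (simp add: algebra_simps)
    moreover have "0 < Nq y"
      using le_less_trans[OF Q.N_nonneg y] \<open>0 < \<epsilon>\<close> by (simp add: zero_less_mult_iff)
    ultimately show False by simp
  qed
  then show ?thesis
    unfolding g_def using \<rho>(1) s order_trans[OF \<rho>(2) Nq_le_N]
    by (intro exI[of _ s] exI[of _ \<rho>] conjI allI)
qed

end

section \<open>The Frobenius argument in the quotient\<close>

lemma scaleR_double:
  fixes y :: "'u::real_vector"
  shows "(2 * a) *\<^sub>R y = a *\<^sub>R y + a *\<^sub>R y" "(a * 2) *\<^sub>R y = a *\<^sub>R y + a *\<^sub>R y"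
    "(a * (b * 2)) *\<^sub>R y = (a * b) *\<^sub>R y + (a * b) *\<^sub>R y"
  by (simp_all flip: scaleR_add_left)

context square_maximal
begin

text \<open>This ties the modulus in the quotient to \<open>p\<close>: \<rho>^n is at most
  \<open>N (a ^ n)\<close>, which grows no faster than \<open>p a ^ n\<close>.\<close>

lemma quadratic_radius_le:
  assumes "a \<in> I"
  obtains s \<rho> where "0 \<le> \<rho>" "\<bar>s\<bar> \<le> \<rho>" "\<rho> \<le> p a" "a * a - (2 * s) *\<^sub>R a + \<rho>\<^sup>2 *\<^sub>R 1 \<in> L"
proof -
  obtain s \<rho> where *: "0 \<le> \<rho>" "\<bar>s\<bar> \<le> \<rho>" "a * a - (2 * s) *\<^sub>R a + \<rho>\<^sup>2 *\<^sub>R 1 \<in> L"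
    and pow: "\<And>n. \<rho> ^ n \<le> N (a ^ n)"
    using quadratic_mod_L[of a] by auto
  have "\<rho> \<le> p a"
  proof (rule le_of_power_le)
    fix n
    show "\<exists>m\<ge>n. \<rho> ^ m \<le> max 1 M * p a ^ m"
      using order_trans[OF pow N_power_le[OF assms]] by blast
  qed (use * p_nonneg in auto)
  with * that show ?thesis by blast
qed

text \<open>Modulo \<open>L\<close>, b = c a + d. If d = 0, the anticommutator is 2 c a^2, a scalar.
  Otherwise squaring b shows that 2 c d a is a scalar; here c is nonzero, as d^2 = -B is impossible,
  so a itself is a scalar.\<close>

lemma anticommutator_of_dependent:
  assumes a: "a * a + A *\<^sub>R 1 \<in> L" and b: "b * b + B *\<^sub>R 1 \<in> L" and B: "0 \<le> B"
    and dep: "\<mu> *\<^sub>R a + \<nu> *\<^sub>R b + \<eta> *\<^sub>R 1 \<in> L" and \<nu>: "\<nu> \<noteq> 0"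
  shows "\<exists>k. a * b + b * a - k *\<^sub>R 1 \<in> L"
proof -
  define c where "c = - (\<mu> / \<nu>)"
  define d where "d = - (\<eta> / \<nu>)"
  define r where "r = b - (c *\<^sub>R a + d *\<^sub>R 1)"
  have "r = inverse \<nu> *\<^sub>R (\<mu> *\<^sub>R a + \<nu> *\<^sub>R b + \<eta> *\<^sub>R 1)"
    using \<nu> by (simp add: r_def c_def d_def algebra_simps divide_inverse)
  then have r: "r \<in> L" using L_scaleR[OF dep] by (simp only:)
  have comm: "a * b + b * a = a * r + r * a + c *\<^sub>R (a * a) + c *\<^sub>R (a * a) + d *\<^sub>R a + d *\<^sub>R a"
    by (simp add: r_def algebra_simps scaleR_double)
  show ?thesis
  proof (cases "d = 0")
    case True
    have "a * b + b * a - (- (c * A) - c * A) *\<^sub>R 1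
        = a * r + r * a + c *\<^sub>R (a * a + A *\<^sub>R 1) + c *\<^sub>R (a * a + A *\<^sub>R 1)"
      unfolding comm using True by (simp add: algebra_simps scaleR_double)
    also have "\<dots> \<in> L" by (simp only: L_add L_scaleR L_left L_right a r)
    finally show ?thesis by blast
  next
    case False
    define x where "x = c *\<^sub>R a + d *\<^sub>R 1"
    have "(c * d) *\<^sub>R a + (c * d) *\<^sub>R a + (d * d + B - c * c * A) *\<^sub>R 1
        = (b * b + B *\<^sub>R 1) - (b * r + r * x) - (c * c) *\<^sub>R (a * a + A *\<^sub>R 1)"
      by (simp add: r_def x_def algebra_simps scaleR_double)
    also have "\<dots> \<in> L" by (simp only: L_add L_diff L_scaleR L_left L_right a b r)
    finally have lin: "(c * d) *\<^sub>R a + (c * d) *\<^sub>R a + (d * d + B - c * c * A) *\<^sub>R 1 \<in> L" .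
    have "c \<noteq> 0"
    proof
      assume "c = 0"
      with lin have "d * d + B = 0" by (simp add: L_scaleR_one_iff)
      moreover have "0 < d * d" using False by (metis not_real_square_gt_zero)
      ultimately show False using B by linarith
    qed
    define m where "m = 2 * (c * d)"
    have m: "m \<noteq> 0" "(c * d) *\<^sub>R a + (c * d) *\<^sub>R a = m *\<^sub>R a"
      using \<open>c \<noteq> 0\<close> False by (simp_all add: m_def scaleR_double)
    define e where "e = - (inverse m * (d * d + B - c * c * A))"
    have "a - e *\<^sub>R 1 = inverse m *\<^sub>R
        ((c * d) *\<^sub>R a + (c * d) *\<^sub>R a + (d * d + B - c * c * A) *\<^sub>R 1)"
      unfolding m(2) e_def scaleR_add_right scaleR_scaleR using m(1) by simp
    then have e: "a - e *\<^sub>R 1 \<in> L" using L_scaleR[OF lin] by (simp only:)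
    have "a * b + b * a - (d * e + d * e - c * A - c * A) *\<^sub>R 1
        = a * r + r * a + c *\<^sub>R (a * a + A *\<^sub>R 1) + c *\<^sub>R (a * a + A *\<^sub>R 1)
          + d *\<^sub>R (a - e *\<^sub>R 1) + d *\<^sub>R (a - e *\<^sub>R 1)"
      unfolding comm by (simp add: algebra_simps scaleR_double)
    also have "\<dots> \<in> L" by (simp only: L_add L_scaleR L_left L_right a r e)
    finally show ?thesis by blast
  qed
qed

text \<open>The squares of a + b and a - b add up to a scalar, so their quadratic equations leave a
  linear relation between a, b and 1. If it is trivial, then t = 0, the square of a + b is a scalar,
  and polarization finishes.\<close>

lemma anticommutator_mod_L:
  assumes a: "a * a + A *\<^sub>R 1 \<in> L" and b: "b * b + B *\<^sub>R 1 \<in> L" and A: "0 \<le> A" and B: "0 \<le> B"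
  shows "\<exists>k. a * b + b * a - k *\<^sub>R 1 \<in> L"
proof -
  have "\<exists>t m. x * x - t *\<^sub>R x + m *\<^sub>R 1 \<in> L" for x
    using quadratic_mod_L[of x] by blast
  then obtain t m t' m' where u: "(a + b) * (a + b) - t *\<^sub>R (a + b) + m *\<^sub>R 1 \<in> L"
    and v: "(a - b) * (a - b) - t' *\<^sub>R (a - b) + m' *\<^sub>R 1 \<in> L" by metis
  define \<eta> where "\<eta> = A + A + B + B - m - m'"
  have "(t + t') *\<^sub>R a + (t - t') *\<^sub>R b + \<eta> *\<^sub>R 1
      = (a * a + A *\<^sub>R 1) + (a * a + A *\<^sub>R 1) + (b * b + B *\<^sub>R 1) + (b * b + B *\<^sub>R 1)
        - ((a + b) * (a + b) - t *\<^sub>R (a + b) + m *\<^sub>R 1) - ((a - b) * (a - b) - t' *\<^sub>R (a - b) + m' *\<^sub>R 1)"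
    by (simp add: \<eta>_def algebra_simps scaleR_double)
  also have "\<dots> \<in> L" by (simp only: L_diff L_add a b u v)
  finally have dep: "(t + t') *\<^sub>R a + (t - t') *\<^sub>R b + \<eta> *\<^sub>R 1 \<in> L" .
  consider "t - t' \<noteq> 0" | "t + t' \<noteq> 0" | "t = 0" by linarith
  then show ?thesis
  proof cases
    case 1
    show ?thesis by (rule anticommutator_of_dependent[OF a b B dep 1])
  next
    case 2
    have "(t - t') *\<^sub>R b + (t + t') *\<^sub>R a + \<eta> *\<^sub>R 1 \<in> L" using dep by (simp add: add.commute)
    then show ?thesis using anticommutator_of_dependent[OF b a A _ 2] by (simp add: add.commute)
  next
    case 3
    have "a * b + b * a - (A + B - m) *\<^sub>R 1
        = ((a + b) * (a + b) - t *\<^sub>R (a + b) + m *\<^sub>R 1) - (a * a + A *\<^sub>R 1) - (b * b + B *\<^sub>R 1)"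
      using 3 by (simp add: algebra_simps scaleR_double)
    also have "\<dots> \<in> L" by (simp only: L_diff a b u)
    finally show ?thesis by blast
  qed
qed

text \<open>With \<open>a' = 2 * s - a\<close> the conjugate of \<open>a\<close>, the product \<open>b' * a'\<close> is the conjugate of
  \<open>w = a * b\<close>, so \<open>w\<close> is modulo \<open>L\<close> a root of \<open>X\<^sup>2 - k X + \<bar>a\<bar>\<^sup>2 \<bar>b\<bar>\<^sup>2\<close>; comparing with the given
  quadratic polynomial yields \<open>q = \<bar>a\<bar> \<bar>b\<bar>\<close>, unless \<open>w\<close> is a scalar modulo \<open>L\<close>.\<close>

lemma root_radius_le:
  assumes a: "a \<in> I" and b: "b \<in> I" and q: "0 < q" and s: "\<bar>s\<bar> \<le> q"
    and w: "(a * b) * (a * b) - (2 * s) *\<^sub>R (a * b) + q\<^sup>2 *\<^sub>R 1 \<in> L"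
  shows "q \<le> p a * p b"
proof -
  obtain sa ra where ra: "0 \<le> ra" "\<bar>sa\<bar> \<le> ra" "ra \<le> p a" and ga: "a * a - (2 * sa) *\<^sub>R a + ra\<^sup>2 *\<^sub>R 1 \<in> L"
    using quadratic_radius_le[OF a] by blast
  obtain sb rb where rb: "0 \<le> rb" "\<bar>sb\<bar> \<le> rb" "rb \<le> p b" and gb: "b * b - (2 * sb) *\<^sub>R b + rb\<^sup>2 *\<^sub>R 1 \<in> L"
    using quadratic_radius_le[OF b] by blast
  define w where "w = a * b"
  have gw: "w * w - (2 * s) *\<^sub>R w + q\<^sup>2 *\<^sub>R 1 \<in> L" unfolding w_def by (rule w)
  \<comment> \<open>Completing the square gives elements with scalar squares; the bounds on
    \<open>sa\<close> and \<open>sb\<close> make these scalars nonpositive, as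
    \<open>anticommutator_mod_L\<close> requires.\<close>
  have "(a - sa *\<^sub>R 1) * (a - sa *\<^sub>R 1) + (ra\<^sup>2 - sa\<^sup>2) *\<^sub>R 1 \<in> L"
    using ga by (simp add: algebra_simps scaleR_double power2_eq_square)
  moreover have "(b - sb *\<^sub>R 1) * (b - sb *\<^sub>R 1) + (rb\<^sup>2 - sb\<^sup>2) *\<^sub>R 1 \<in> L"
    using gb by (simp add: algebra_simps scaleR_double power2_eq_square)
  moreover have "0 \<le> ra\<^sup>2 - sa\<^sup>2" "0 \<le> rb\<^sup>2 - sb\<^sup>2"
    using ra rb by (auto simp: abs_le_square_iff[symmetric])
  ultimately obtain k where k:
    "(a - sa *\<^sub>R 1) * (b - sb *\<^sub>R 1) + (b - sb *\<^sub>R 1) * (a - sa *\<^sub>R 1) - k *\<^sub>R 1 \<in> L"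
    using anticommutator_mod_L by blast
  define a' where "a' = (2 * sa) *\<^sub>R 1 - a"
  define b' where "b' = (2 * sb) *\<^sub>R 1 - b"
  define k' where "k' = k + 2 * (sa * sb)"
  have sum: "w + b' * a' - k' *\<^sub>R 1 \<in> L"
    using k by (simp add: w_def a'_def b'_def k'_def algebra_simps scaleR_double)
  have prod: "w * (b' * a') - (ra\<^sup>2 * rb\<^sup>2) *\<^sub>R 1 \<in> L"
  proof -
    have "w * (b' * a') - (ra\<^sup>2 * rb\<^sup>2) *\<^sub>R 1
        = - (rb\<^sup>2 *\<^sub>R (a * a - (2 * sa) *\<^sub>R a + ra\<^sup>2 *\<^sub>R 1)) - a * (b * b - (2 * sb) *\<^sub>R b + rb\<^sup>2 *\<^sub>R 1) * a'"
      by (simp add: w_def a'_def b'_def algebra_simps scaleR_double)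
    also have "\<dots> \<in> L" by (simp only: L_diff L_uminus L_scaleR L_left L_right ga gb)
    finally show ?thesis .
  qed
  have "(k' - 2 * s) *\<^sub>R w + (q\<^sup>2 - ra\<^sup>2 * rb\<^sup>2) *\<^sub>R 1
      = (w * w - (2 * s) *\<^sub>R w + q\<^sup>2 *\<^sub>R 1) - (w * (w + b' * a' - k' *\<^sub>R 1) - (w * (b' * a') - (ra\<^sup>2 * rb\<^sup>2) *\<^sub>R 1))"
    by (simp add: algebra_simps scaleR_double)
  also have "\<dots> \<in> L" by (rule L_diff[OF gw L_diff[OF L_left[OF sum] prod]])
  finally have lin: "(k' - 2 * s) *\<^sub>R w + (q\<^sup>2 - ra\<^sup>2 * rb\<^sup>2) *\<^sub>R 1 \<in> L" .
  show ?thesis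
  proof (cases "k' - 2 * s = 0")
    case True
    with lin have "q\<^sup>2 = (ra * rb)\<^sup>2" by (simp add: L_scaleR_one_iff power_mult_distrib)
    then have "q = ra * rb" using q ra rb by (simp add: power2_eq_iff_nonneg)
    also have "\<dots> \<le> p a * p b" using ra rb by (intro mult_mono) auto
    finally show ?thesis .
  next
    case False
    \<comment> \<open>Now \<open>w\<close> is the real scalar r modulo \<open>L\<close>. A real root
      of a quadratic whose conjugate roots have modulus q satisfies \<bar>r\<bar> = q.\<close>
    define r where "r = - ((q\<^sup>2 - ra\<^sup>2 * rb\<^sup>2) / (k' - 2 * s))"
    have "w - r *\<^sub>R 1 = inverse (k' - 2 * s) *\<^sub>R ((k' - 2 * s) *\<^sub>R w + (q\<^sup>2 - ra\<^sup>2 * rb\<^sup>2) *\<^sub>R 1)"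
      using False by (simp add: r_def scaleR_add_right divide_inverse mult.commute)
    then have r: "w - r *\<^sub>R 1 \<in> L" using L_scaleR[OF lin] by (simp only:)
    have "(r * r - 2 * s * r + q\<^sup>2) *\<^sub>R 1 = (w * w - (2 * s) *\<^sub>R w + q\<^sup>2 *\<^sub>R 1)
        - (w * (w - r *\<^sub>R 1) + r *\<^sub>R (w - r *\<^sub>R 1) - (2 * s) *\<^sub>R (w - r *\<^sub>R 1))"
      by (simp add: algebra_simps scaleR_double)
    also have "\<dots> \<in> L" 
      by (rule L_diff[OF gw L_diff[OF L_add[OF L_left[OF r] L_scaleR[OF r]] L_scaleR[OF r]]])
    finally have "r * r - 2 * s * r + q\<^sup>2 = 0" by (simp only: L_scaleR_one_iff)
    then have "(r - s)\<^sup>2 + (q\<^sup>2 - s\<^sup>2) = 0" by (simp add: power2_eq_square algebra_simps scaleR_double)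
    moreover have sq: "0 \<le> q\<^sup>2 - s\<^sup>2" using s q abs_le_square_iff[of s q] by simp
    ultimately have "(r - s)\<^sup>2 = 0 \<and> q\<^sup>2 - s\<^sup>2 = 0"
      using zero_le_power2[of "r - s"] by linarith
    then have "r\<^sup>2 = q\<^sup>2" by simp
    then have rq: "\<bar>r\<bar> = q" using q by (metis abs_of_pos power2_eq_iff abs_minus)
    \<comment> \<open>The innermost factor a b collapses to r, so a^n b^n is r^n modulo
      \<open>L\<close> without any commutation.\<close>
    have pow: "a ^ n * b ^ n - r ^ n *\<^sub>R 1 \<in> L" for n
    proof (induction n)
      case (Suc n)
      have "a ^ Suc n * b ^ Suc n - r ^ Suc n *\<^sub>R 1
          = a * (a ^ n * b ^ n - r ^ n *\<^sub>R 1) * b + r ^ n *\<^sub>R (w - r *\<^sub>R 1)"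
        by (simp add: w_def algebra_simps power_commutes)
      also have "\<dots> \<in> L" by (simp only: L_add L_left L_right L_scaleR Suc r)
      finally show ?case .
    qed simp
    show ?thesis
    proof (rule le_of_power_le)
      fix n
      have "1 - inverse (r ^ n) *\<^sub>R (a ^ n * b ^ n) = - (inverse (r ^ n) *\<^sub>R (a ^ n * b ^ n - r ^ n *\<^sub>R 1))"
        using rq q by (auto simp: scaleR_diff_right)
      also have "\<dots> \<in> L" by (simp only: L_uminus L_scaleR pow)
      finally have "1 \<le> N (inverse (r ^ n) *\<^sub>R (a ^ n * b ^ n))"
        using L_apart by fastforce
      then have "q ^ n \<le> N (a ^ n * b ^ n)"
        using rq q by (simp add: N_scaleR abs_inverse power_abs field_simps)
      also have "\<dots> \<le> (max 1 M * p a ^ n) * (max 1 M * p b ^ n)"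
        by (intro N_mult_le N_power_le a b)
      also have "\<dots> = (max 1 M * max 1 M) * (p a * p b) ^ n" by (simp add: power_mult_distrib)
      finally show "\<exists>m\<ge>n. q ^ m \<le> (max 1 M * max 1 M) * (p a * p b) ^ m" by blast
    qed (use q p_nonneg in auto)
  qed
qed

end

context square_ideal
begin

theorem p_submultiplicative:
  assumes a: "a \<in> I" and b: "b \<in> I"
  shows "p (a * b) \<le> p a * p b"
proof (cases "p (a * b) = 0")
  case True
  then show ?thesis by (simp add: p_nonneg)
next
  case False
  define w where "w = a * b"
  define q where "q = p w"
  have q: "0 < q" using False p_nonneg[of w] by (simp add: q_def w_def)
  have w: "w \<in> I" by (simp add: w_def I_right a)
  have "\<exists>C. \<forall>n. N (w ^ n) \<le> C * \<sigma> ^ n" if "q < \<sigma>" for \<sigma>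
  proof (intro exI allI)
    fix n
    have "N (w ^ n) \<le> max 1 M * q ^ n" unfolding q_def by (rule N_power_le[OF w])
    also have "\<dots> \<le> max 1 M * \<sigma> ^ n" using that q by (intro mult_left_mono power_mono) auto
    finally show "N (w ^ n) \<le> max 1 M * \<sigma> ^ n" .
  qed
  then obtain s where s: "\<bar>s\<bar> \<le> q"
    and root: "\<forall>\<epsilon>>0. \<exists>y. N ((w * w - (2 * s) *\<^sub>R w + q\<^sup>2 *\<^sub>R 1) * y) < \<epsilon> * N y"
    using approximate_root[of q w] q N_power_ge[OF w] by (auto simp: q_def)
  define g where "g = w * w - (2 * s) *\<^sub>R w + q\<^sup>2 *\<^sub>R 1"
  define J where "J = range (\<lambda>c. c * g)"
  have "left_ideal J"
    unfolding left_ideal_def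
  proof (intro conjI ballI allI)
    show "0 \<in> J" unfolding J_def by (rule range_eqI[of _ _ 0]) simp
    show "x + y \<in> J" if "x \<in> J" "y \<in> J" for x y
      using that by (auto simp: J_def simp flip: distrib_right)
    show "u * x \<in> J" if "x \<in> J" for u x
      using that by (auto simp: J_def simp flip: mult.assoc)
  qed
  moreover have "1 \<le> N (1 - c * g)" for c
  proof (rule ccontr)
    assume "\<not> 1 \<le> N (1 - c * g)"
    \<comment> \<open>With this \<epsilon>, an approximate root vector y would satisfy
      \<open>N y < N y\<close>; the summand 1 covers \<open>N c = 0\<close>.\<close>
    define \<epsilon> where "\<epsilon> = (1 - N (1 - c * g)) / (N c + 1)"
    have "0 < N c + 1" by (simp add: add_nonneg_pos)
    then have \<epsilon>: "0 < \<epsilon>" "N c * \<epsilon> \<le> 1 - N (1 - c * g)"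
      using \<open>\<not> 1 \<le> N (1 - c * g)\<close> by (auto simp: \<epsilon>_def field_simps)
    from \<epsilon>(1) obtain y where y: "N (g * y) < \<epsilon> * N y" using root unfolding g_def by blast
    then have y0: "0 < N y" using le_less_trans[OF N_nonneg y] \<epsilon> by (simp add: zero_less_mult_iff)
    have "N c * N (g * y) \<le> (N c + 1) * N (g * y)" by (simp add: distrib_right)
    also have "\<dots> < (N c + 1) * (\<epsilon> * N y)"
      using y \<open>0 < N c + 1\<close> by (intro mult_strict_left_mono)
    also have "\<dots> = (1 - N (1 - c * g)) * N y" using \<open>0 < N c + 1\<close> by (simp add: \<epsilon>_def)
    finally have lt: "N c * N (g * y) < (1 - N (1 - c * g)) * N y" .
    have "N y = N ((1 - c * g) * y + c * (g * y))" by (simp add: algebra_simps)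
    also have "\<dots> \<le> N ((1 - c * g) * y) + N (c * (g * y))" by (rule N_add)
    also have "\<dots> \<le> N (1 - c * g) * N y + N c * N (g * y)" by (intro add_mono N_mult)
    also have "\<dots> < N y" using lt by (simp add: algebra_simps)
    finally show False by simp
  qed
  ultimately have "proper_left_ideal J" unfolding proper_left_ideal_def J_def by blast
  then obtain L where L: "J \<subseteq> L" "proper_left_ideal L"
    and max: "\<forall>K. proper_left_ideal K \<longrightarrow> L \<subseteq> K \<longrightarrow> K = L"
    using maximal_left_ideal_exists by blast
  interpret maximal_left_ideal N L by unfold_locales (use L max in blast)+
  have g: "g \<in> L"
  proof -
    have "1 * g \<in> J" unfolding J_def by (rule rangeI)
    then show ?thesis using L(1) by auto
  qed
  have "\<not> I \<subseteq> L"
  proof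
    assume "I \<subseteq> L"
    then have wL: "w \<in> L" using w by blast
    have "q\<^sup>2 *\<^sub>R 1 = g - (w * w - (2 * s) *\<^sub>R w)" by (simp add: g_def)
    also have "\<dots> \<in> L" by (simp only: L_diff L_left L_scaleR g wL)
    finally show False using q by (simp add: L_scaleR_one_iff)
  qed
  then interpret square_maximal N I p M L by unfold_locales
  show ?thesis
    using root_radius_le[OF a b q s] g by (simp add: g_def w_def q_def)
qed

end

section \<open>Unitization\<close>

datatype 'a unitization = Unitize (scalar: real) (vec: 'a)

lemma unitization_eq_iff: "x = y \<longleftrightarrow> scalar x = scalar y \<and> vec x = vec y"
  by (cases x; cases y) simp

instantiation unitization :: (real_algebra) real_algebra_1
begin

definition "0 = Unitize 0 0"
definition "1 = Unitize 1 0"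
definition "x + y = Unitize (scalar x + scalar y) (vec x + vec y)"
definition "x - y = Unitize (scalar x - scalar y) (vec x - vec y)"
definition "- x = Unitize (- scalar x) (- vec x)"
definition "c *\<^sub>R x = Unitize (c * scalar x) (c *\<^sub>R vec x)"
definition "x * y = Unitize (scalar x * scalar y) (scalar x *\<^sub>R vec y + scalar y *\<^sub>R vec x + vec x * vec y)"

lemmas unitization_defs = zero_unitization_def one_unitization_def plus_unitization_def
  minus_unitization_def uminus_unitization_def scaleR_unitization_def times_unitization_def

instance
  by standard (simp_all add: unitization_eq_iff unitization_defs algebra_simps)

end

section \<open>Boundedness of the product via Jordan polynomials\<close>

text \<open>Homogenization. A seminorm can vanish at nonzero vectors, so the scaling uses
  \<open>p x + e\<close> and \<open>p y + e\<close>, with e tending to 0 from the right.\<close>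

lemma bilinear_seminorm_bound:
  fixes f :: "'a::real_vector \<Rightarrow> 'a \<Rightarrow> 'b::real_vector"
  assumes p: "seminorm p" and q: "seminorm q"
    and f: "\<And>c d x y. f (c *\<^sub>R x) (d *\<^sub>R y) = (c * d) *\<^sub>R f x y"
    and le: "\<And>x y. p x \<le> 1 \<Longrightarrow> p y \<le> 1 \<Longrightarrow> q (f x y) \<le> C"
  shows "q (f x y) \<le> C * (p x * p y)"
proof -
  have p0: "0 \<le> p z" and pc: "p (c *\<^sub>R z) = \<bar>c\<bar> * p z" for c z using p by (auto simp: seminorm_def)
  have qc: "q (c *\<^sub>R z) = \<bar>c\<bar> * q z" for c z using q by (auto simp: seminorm_def)
  have bound: "q (f x y) \<le> C * ((p x + e) * (p y + e))" if e: "0 < e" for e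
  proof -
    define c where "c = p x + e"
    define d where "d = p y + e"
    have pos: "0 < c" "0 < d" using e p0 by (auto simp: c_def d_def add_nonneg_pos)
    have "q (f (inverse c *\<^sub>R x) (inverse d *\<^sub>R y)) \<le> C"
      using pos e by (intro le) (auto simp: pc c_def d_def field_simps)
    then have "inverse (c * d) * q (f x y) \<le> C" using pos by (simp add: f qc abs_mult)
    then have "q (f x y) \<le> C * (c * d)" using pos by (simp add: field_simps)
    then show ?thesis by (simp add: c_def d_def)
  qed
  have "((\<lambda>e. C * ((p x + e) * (p y + e))) \<longlongrightarrow> C * ((p x + 0) * (p y + 0))) (at_right 0)"
    by (intro tendsto_intros)
  then have "q (f x y) \<le> C * ((p x + 0) * (p y + 0))"
    by (rule tendsto_lowerbound) (auto intro!: eventually_at_rightI[of 0 1] bound)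
  then show ?thesis by simp
qed

text \<open>All terms below are Jordan polynomials, hence controlled by squares:
  \<open>2 x y x = x \<circ> (x \<circ> y) - x\<^sup>2 \<circ> y\<close> and \<open>(x y - y x)\<^sup>2 = x \<circ> (y x y) - x y\<^sup>2 x - y x\<^sup>2 y\<close>,
  where \<open>x \<circ> y = x y + y x\<close>.\<close>

lemma square_seminorm_product_bound:
  fixes p :: "'a::real_algebra \<Rightarrow> real"
  assumes p: "seminorm p" and sq: "square_property p"
  shows "p (x * y) \<le> 6 * (p x * p y)"
proof (rule bilinear_seminorm_bound[OF p p])
  have p0: "0 \<le> p z" and padd: "p (z + z') \<le> p z + p z'" and pc: "p (c *\<^sub>R z) = \<bar>c\<bar> * p z"
    and psq: "p (z * z) = (p z)\<^sup>2" for c z z'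
    using p sq by (auto simp: seminorm_def square_property_def)
  have pdiff: "p (z - z') \<le> p z + p z'" for z z'
    using padd[of z "- z'"] pc[of "-1" z'] by simp
  have p2: "p (z + z) = 2 * p z" for z using pc[of 2 z] by (simp add: scaleR_2)
  have jordan: "p (x * y + y * x) \<le> 4 * (p x * p y)" for x y
  proof (rule bilinear_seminorm_bound[OF p p])
    fix x y assume le: "p x \<le> 1" "p y \<le> 1"
    have "p (x + y) \<le> 2" "p (x - y) \<le> 2" using le padd[of x y] pdiff[of x y] by linarith+
    then have "p ((x + y) * (x + y)) \<le> 2\<^sup>2" "p ((x - y) * (x - y)) \<le> 2\<^sup>2"
      using power_mono[of "p (x + y)" 2 2] power_mono[of "p (x - y)" 2 2] by (simp_all add: psq p0)
    moreover have "(x * y + y * x) + (x * y + y * x) = (x + y) * (x + y) - (x - y) * (x - y)"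
      by (simp add: algebra_simps)
    ultimately show "p (x * y + y * x) \<le> 4"
      using p2[of "x * y + y * x"] pdiff[of "(x + y) * (x + y)" "(x - y) * (x - y)"] by simp
  qed (simp add: scaleR_add_right mult.commute)
  have jordan_le: "p (x * y + y * x) \<le> 4 * (a * b)" if "p x \<le> a" "p y \<le> b" for x y a b
    using jordan[of x y] mult_mono[OF that] p0[of x] p0[of y] that by (auto intro: order_trans)
  \<comment> \<open>The bound 10 is half of 16 + 4, the bounds of the two Jordan terms.\<close>
  have triple: "p (x * y * x) \<le> 10" if le: "p x \<le> 1" "p y \<le> 1" for x y
  proof -
    have "p (x * (x * y + y * x) + (x * y + y * x) * x) \<le> 4 * (1 * 4)"
      using jordan_le[OF le] le by (intro jordan_le) auto
    moreover have "p ((x * x) * y + y * (x * x)) \<le> 4 * (1 * 1)"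
      using le p0 by (intro jordan_le) (auto simp: psq power_le_one)
    moreover have "x * y * x + x * y * x
        = (x * (x * y + y * x) + (x * y + y * x) * x) - ((x * x) * y + y * (x * x))"
      by (simp add: algebra_simps)
    ultimately show ?thesis
      using p2[of "x * y * x"] pdiff[of "x * (x * y + y * x) + (x * y + y * x) * x" "(x * x) * y + y * (x * x)"]
      by simp
  qed
  fix x y assume le: "p x \<le> 1" "p y \<le> 1"
  have le': "p (x * x) \<le> 1" "p (y * y) \<le> 1" using le p0 by (auto simp: psq power_le_one)
  have "(p (x * y - y * x))\<^sup>2 = p ((x * (y * x * y) + (y * x * y) * x) - x * (y * y) * x - y * (x * x) * y)"
    by (simp add: algebra_simps flip: psq)
  also have "\<dots> \<le> p (x * (y * x * y) + (y * x * y) * x) + p (x * (y * y) * x) + p (y * (x * x) * y)"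
    by (meson pdiff add_right_mono order_trans)
  also have "\<dots> \<le> 4 * (1 * 10) + 10 + 10"
    using le le' by (intro add_mono jordan_le triple)
  \<comment> \<open>The sum 60 is rounded up to the square 64; the final 6 is half of 4 + 8.\<close>
  finally have "(p (x * y - y * x))\<^sup>2 \<le> 8\<^sup>2" by simp
  then have "p (x * y - y * x) \<le> 8" by (rule power2_le_imp_le) simp
  moreover have "p (x * y + y * x) \<le> 4 * (1 * 1)" using le by (rule jordan_le)
  moreover have "x * y + x * y = (x * y + y * x) + (x * y - y * x)" by simp
  ultimately show "p (x * y) \<le> 6"
    using p2[of "x * y"] padd[of "x * y + y * x" "x * y - y * x"] by simp
qed simp

theorem theorem3p2:
  fixes p :: "'a::real_algebra \<Rightarrow> real"
  assumes "seminorm p"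
    and "square_property p"
  shows "submultiplicative p"
proof -
  have p0: "0 \<le> p z" and padd: "p (z + z') \<le> p z + p z'" and pc: "p (c *\<^sub>R z) = \<bar>c\<bar> * p z"
    and psq: "p (z * z) = (p z)\<^sup>2" for c z z'
    using assms by (auto simp: seminorm_def square_property_def)
  have prod: "p (y * z) \<le> 6 * (p y * p z)" for y z
    by (rule square_seminorm_product_bound[OF assms])
  have pz: "p 0 = 0" using pc[of 0 0] by simp
  \<comment> \<open>With the weight 6, the constant of \<open>prod\<close>, the bound obtained for
    \<open>N (x * y)\<close> is exactly the expansion of \<open>N x * N y\<close>. On the ideal,
    \<open>N\<close> is 6 times \<open>p\<close>, whence \<open>M\<close> is 6.\<close>
  define N where "N = (\<lambda>x :: 'a unitization. \<bar>scalar x\<bar> + 6 * p (vec x))"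
  interpret square_ideal N "{x. scalar x = 0}" "\<lambda>x. p (vec x)" 6
  proof
    fix x y :: "'a unitization" and c :: real
    show "N (x + y) \<le> N x + N y"
      using padd[of "vec x" "vec y"] by (simp add: N_def unitization_defs)
    show "N (c *\<^sub>R x) = \<bar>c\<bar> * N x"
      by (simp add: N_def unitization_defs pc abs_mult algebra_simps)
    show "N 1 = 1" by (simp add: N_def unitization_defs pz)
    have "p (vec (x * y)) \<le> p (scalar x *\<^sub>R vec y) + p (scalar y *\<^sub>R vec x) + p (vec x * vec y)"
      unfolding times_unitization_def unitization.sel by (meson padd add_right_mono order_trans)
    also have "\<dots> \<le> \<bar>scalar x\<bar> * p (vec y) + \<bar>scalar y\<bar> * p (vec x) + 6 * (p (vec x) * p (vec y))"
      using prod by (simp add: pc)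
    finally show "N (x * y) \<le> N x * N y"
      by (simp add: N_def times_unitization_def abs_mult algebra_simps)
  qed (auto simp: N_def unitization_defs p0 padd pc psq)
  have "p (a * b) \<le> p a * p b" for a b
    using p_submultiplicative[of "Unitize 0 a" "Unitize 0 b"] by (simp add: times_unitization_def)
  then show ?thesis by (simp add: submultiplicative_def)
qed

end
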